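(* Let $\Omega\subset\mathbb R^N$ ($N\ge2$) be an exterior domain of class $C^2$. Then for all $e\in\mathbb S^{N-1}$, $z\in\mathbb R^N$ and $(u_0,v_0)\in\Theta$, $$w_*(e,u_0,v_0)\le w_*(e,z,u_0,v_0)\le w^*(e,z,u_0,v_0)\le w^*(e,u_0,v_0)\le 2\sqrt{r_1}\max\big(\sqrt{d_1},\sqrt{d_2/2}\big).$$
   Context: An exterior domain is a non-empty connected open $\Omega\subset\mathbb R^N$ with $\mathbb R^N\setminus\Omega$ compact. Fix positive constants $d_1,d_2,r_1,r_2,a_1,a_2$ with $0<a_1<1<a_2$. $\Theta$ is the set of pairs $(u_0,v_0)$ with $u_0,v_0\in C(\overline\Omega,[0,1])$, $u_0\not\equiv 0$, $(u_0,v_0)=(0,1)$ outside a compact subset of $\overline\Omega$; $(u,v)$ is the solution of $u_t=d_1\Delta u+r_1u(1-u-a_1v)$, $v_t=d_2\Delta v+r_2v(1-v-a_2u)$ in $(0,\infty)\times\Omega$, homogeneous Neumann conditions on $\partial\Omega$, $(u,v)(0,\cdot)=(u_0,v_0)$ (for exterior domains one has $(u,v)\to(1,0)$ locally uniformly, so all speeds below are defined). $R(e)=\inf\{R\ge0:\exists s,\ \forall s'\ge s,\ \overline{B(s'e,R)}\cap\overline\Omega\ne\emptyset\}$. $w^*(e,u_0,v_0)=\inf\{c>0:\forall A>R(e),\ \lim_{t\to\infty}\sup_{s\ge ct,\,x\in\overline{B(se,A)}\cap\overline\Omega}(|u|+|1-v|)(t,x)=0\}$ ($+\infty$ if empty);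 $w^*(e,z,u_0,v_0)$: same with "$\exists A>0$" and $B(z+se,A)$. $w_*(e,u_0,v_0)=\sup\{c>0:\forall A>R(e),\ \limsup_{\tau,t\to\infty,\,\tau\le ct}\sup_{\tau\le s\le ct,\,x\in\overline{B(se,A)}\cap\overline\Omega}(|1-u|+|v|)(t,x)=0\}$ ($0$ if empty); $w_*(e,z,u_0,v_0)$: same with "$\exists A>0$" and $B(z+se,A)$. *)

theory Defs
  imports "HOL-Analysis.Analysis" "HOL-Library.Extended_Real"
begin

definition exterior_domain :: "'a::euclidean_space set \<Rightarrow> bool" where
  "exterior_domain \<Omega> \<longleftrightarrow> \<Omega> \<noteq> {} \<and> open \<Omega> \<and> connected \<Omega> \<and> compact (- \<Omega>)"

definition C2_domain :: "'a::euclidean_space set \<Rightarrow> bool" where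
  "C2_domain \<Omega> \<longleftrightarrow> open \<Omega> \<and>
    (\<forall>p\<in>frontier \<Omega>. \<exists>(\<phi>::'a\<Rightarrow>real) D\<phi> H r. r > 0 \<and>
       (\<forall>x. (\<phi> has_derivative (\<lambda>h. inner h (D\<phi> x))) (at x) \<and>
            (D\<phi> has_derivative blinfun_apply (H x)) (at x)) \<and>
       continuous_on UNIV H \<and> D\<phi> p \<noteq> 0 \<and>
       \<Omega> \<inter> ball p r = {x \<in> ball p r. \<phi> x < 0})"

definition outward_normal :: "'a::euclidean_space set \<Rightarrow> 'a \<Rightarrow> 'a \<Rightarrow> bool" where
  "outward_normal \<Omega> p g \<longleftrightarrow> g \<noteq> 0 \<and>
    (\<exists>(\<phi>::'a\<Rightarrow>real) r. r > 0 \<and> GDERIV \<phi> p :> g \<and> \<Omega> \<inter> ball p r = {x \<in> ball p r. \<phi> x < 0})"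

definition reaction_diffusion_sol ::
  "'a::euclidean_space set \<Rightarrow> real \<Rightarrow> (real \<Rightarrow> 'a \<Rightarrow> real) \<Rightarrow> (real \<Rightarrow> 'a \<Rightarrow> real) \<Rightarrow> bool" where
  "reaction_diffusion_sol \<Omega> d F w \<longleftrightarrow>
    (\<exists>Wt Dw Hw.
      continuous_on ({0::real<..} \<times> closure \<Omega>) (\<lambda>(t,x). Wt t x) \<and>
      continuous_on ({0::real<..} \<times> closure \<Omega>) (\<lambda>(t,x). Dw t x) \<and>
      continuous_on ({0::real<..} \<times> \<Omega>) (\<lambda>(t,x). Hw t x) \<and>
      (\<forall>t>0. \<forall>x\<in>closure \<Omega>.
         ((\<lambda>s. w s x) has_real_derivative Wt t x) (at t) \<and>
         (w t has_derivative (\<lambda>h. inner h (Dw t x))) (at x within closure \<Omega>)) \<and>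
      (\<forall>t>0. \<forall>x\<in>\<Omega>.
         (Dw t has_derivative blinfun_apply (Hw t x)) (at x) \<and>
         Wt t x = d * (\<Sum>b\<in>Basis. inner (blinfun_apply (Hw t x) b) b) + F t x) \<and>
      (\<forall>t>0. \<forall>p\<in>frontier \<Omega>. \<forall>g. outward_normal \<Omega> p g \<longrightarrow> inner (Dw t p) g = 0))"

definition competition_solution ::
  "'a::euclidean_space set \<Rightarrow> real \<Rightarrow> real \<Rightarrow> real \<Rightarrow> real \<Rightarrow> real \<Rightarrow> real \<Rightarrow>
   ('a \<Rightarrow> real) \<Rightarrow> ('a \<Rightarrow> real) \<Rightarrow> (real \<Rightarrow> 'a \<Rightarrow> real) \<Rightarrow> (real \<Rightarrow> 'a \<Rightarrow> real) \<Rightarrow> bool" where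
  "competition_solution \<Omega> d1 d2 r1 r2 a1 a2 u0 v0 u v \<longleftrightarrow>
    (\<forall>x\<in>closure \<Omega>. u 0 x = u0 x \<and> v 0 x = v0 x) \<and>
    continuous_on ({0::real..} \<times> closure \<Omega>) (\<lambda>(t,x). u t x) \<and>
    continuous_on ({0::real..} \<times> closure \<Omega>) (\<lambda>(t,x). v t x) \<and>
    bounded ((\<lambda>(t,x). u t x) ` ({0::real..} \<times> closure \<Omega>)) \<and>
    bounded ((\<lambda>(t,x). v t x) ` ({0::real..} \<times> closure \<Omega>)) \<and>
    reaction_diffusion_sol \<Omega> d1 (\<lambda>t x. r1 * u t x * (1 - u t x - a1 * v t x)) u \<and>
    reaction_diffusion_sol \<Omega> d2 (\<lambda>t x. r2 * v t x * (1 - v t x - a2 * u t x)) v"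

definition Theta :: "'a::euclidean_space set \<Rightarrow> ('a \<Rightarrow> real) \<Rightarrow> ('a \<Rightarrow> real) \<Rightarrow> bool" where
  "Theta \<Omega> u0 v0 \<longleftrightarrow>
    continuous_on (closure \<Omega>) u0 \<and> continuous_on (closure \<Omega>) v0 \<and>
    (\<forall>x\<in>closure \<Omega>. 0 \<le> u0 x \<and> u0 x \<le> 1 \<and> 0 \<le> v0 x \<and> v0 x \<le> 1) \<and>
    (\<exists>x\<in>closure \<Omega>. u0 x \<noteq> 0) \<and>
    (\<exists>K. compact K \<and> K \<subseteq> closure \<Omega> \<and> (\<forall>x\<in>closure \<Omega> - K. u0 x = 0 \<and> v0 x = 1))"

definition Rdir :: "'a::euclidean_space set \<Rightarrow> 'a \<Rightarrow> ereal" where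
  "Rdir \<Omega> e = Inf (ereal ` {R. R \<ge> 0 \<and>
      (\<exists>s. \<forall>s'\<ge>s. cball (s' *\<^sub>R e) R \<inter> closure \<Omega> \<noteq> {})})"

definition upper_ok :: "'a::euclidean_space set \<Rightarrow> (real \<Rightarrow> 'a \<Rightarrow> real) \<Rightarrow> (real \<Rightarrow> 'a \<Rightarrow> real)
    \<Rightarrow> 'a \<Rightarrow> 'a \<Rightarrow> real \<Rightarrow> real \<Rightarrow> bool" where
  "upper_ok \<Omega> u v e z A c \<longleftrightarrow>
    ((\<lambda>t. Sup ((\<lambda>(s,x). ereal (\<bar>u t x\<bar> + \<bar>1 - v t x\<bar>)) `
        {(s,x). s \<ge> c * t \<and> x \<in> cball (z + s *\<^sub>R e) A \<inter> closure \<Omega>})) \<longlongrightarrow> 0) at_top"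

definition lower_ok :: "'a::euclidean_space set \<Rightarrow> (real \<Rightarrow> 'a \<Rightarrow> real) \<Rightarrow> (real \<Rightarrow> 'a \<Rightarrow> real)
    \<Rightarrow> 'a \<Rightarrow> 'a \<Rightarrow> real \<Rightarrow> real \<Rightarrow> bool" where
  "lower_ok \<Omega> u v e z A c \<longleftrightarrow>
    Limsup (inf (at_top \<times>\<^sub>F at_top) (principal {(\<tau>, t). \<tau> \<le> c * t}))
      (\<lambda>(\<tau>, t). Sup ((\<lambda>(s,x). ereal (\<bar>1 - u t x\<bar> + \<bar>v t x\<bar>)) `
        {(s,x). \<tau> \<le> s \<and> s \<le> c * t \<and> x \<in> cball (z + s *\<^sub>R e) A \<inter> closure \<Omega>})) = 0"

definition w_up :: "'a::euclidean_space set \<Rightarrow> (real \<Rightarrow> 'a \<Rightarrow> real) \<Rightarrow> (real \<Rightarrow> 'a \<Rightarrow> real) \<Rightarrow> 'a \<Rightarrow> ereal" where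
  "w_up \<Omega> u v e = Inf (ereal ` {c. c > 0 \<and> (\<forall>A. ereal A > Rdir \<Omega> e \<longrightarrow> upper_ok \<Omega> u v e 0 A c)})"

definition w_up_z :: "'a::euclidean_space set \<Rightarrow> (real \<Rightarrow> 'a \<Rightarrow> real) \<Rightarrow> (real \<Rightarrow> 'a \<Rightarrow> real) \<Rightarrow> 'a \<Rightarrow> 'a \<Rightarrow> ereal" where
  "w_up_z \<Omega> u v e z = Inf (ereal ` {c. c > 0 \<and> (\<exists>A>0. upper_ok \<Omega> u v e z A c)})"

definition w_low :: "'a::euclidean_space set \<Rightarrow> (real \<Rightarrow> 'a \<Rightarrow> real) \<Rightarrow> (real \<Rightarrow> 'a \<Rightarrow> real) \<Rightarrow> 'a \<Rightarrow> ereal" where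
  "w_low \<Omega> u v e = (let C = {c. c > 0 \<and> (\<forall>A. ereal A > Rdir \<Omega> e \<longrightarrow> lower_ok \<Omega> u v e 0 A c)}
     in if C = {} then 0 else Sup (ereal ` C))"

definition w_low_z :: "'a::euclidean_space set \<Rightarrow> (real \<Rightarrow> 'a \<Rightarrow> real) \<Rightarrow> (real \<Rightarrow> 'a \<Rightarrow> real) \<Rightarrow> 'a \<Rightarrow> 'a \<Rightarrow> ereal" where
  "w_low_z \<Omega> u v e z = (let C = {c. c > 0 \<and> (\<exists>A>0. lower_ok \<Omega> u v e z A c)}
     in if C = {} then 0 else Sup (ereal ` C))"

end

theory Submission
  imports Defs
begin

text \<open>The inequalities between the speeds come from the translation of the balls and from testing both
  limits on the ray \<open>z + c t e\<close>, which eventually lies in the domain. For the upper bound, a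
  maximum principle with Neumann conditions gives \<open>0 \<le> u \<le> 1\<close> and \<open>0 \<le> v \<le> 1\<close>. With
  \<open>c = 2 sqrt (d1 r1)\<close>, the planar waves \<open>exp (- \<kappa> (x \<bullet> e - R - c t))\<close> are at least 1 on the
  obstacle once \<open>R\<close> is large, so they can be compared with \<open>u\<close> and \<open>1 - v\<close> without any condition on
  their normal derivative. For \<open>\<kappa> = sqrt (r1 / d1)\<close> such a wave is a supersolution of the
  linearised equation of \<open>u\<close>. Since \<open>1 - v\<close> solves a heat equation with a source of size at most
  \<open>r2 a2 u\<close>, a multiple of a wave with a smaller rate \<open>\<mu>\<close> and the same speed dominates it.\<close>

subsection \<open>Twice differentiable functions\<close>

lemma second_derivative_nonpos_at_max:
  fixes f :: "'a::euclidean_space \<Rightarrow> real"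
  assumes S: "open S" "x \<in> S"
    and D: "\<And>y. y \<in> S \<Longrightarrow> (f has_derivative (\<lambda>h. h \<bullet> D y)) (at y)"
    and H: "(D has_derivative H) (at x)"
    and max: "\<And>y. y \<in> S \<Longrightarrow> f y \<le> f x"
  shows "H b \<bullet> b \<le> 0"
proof (rule ccontr)
  assume "\<not> H b \<bullet> b \<le> 0"
  then have pos: "H b \<bullet> b > 0" by simp
  have "open ((\<lambda>s::real. x + s *\<^sub>R b) -` S)"
    by (intro open_vimage S continuous_intros)
  then obtain \<epsilon> where \<epsilon>: "\<epsilon> > 0" "ball 0 \<epsilon> \<subseteq> (\<lambda>s::real. x + s *\<^sub>R b) -` S"
    using S(2) open_contains_ball by (metis (no_types, lifting) add.right_neutral scale_zero_left vimageI)
  have inS: "x + s *\<^sub>R b \<in> S" if "\<bar>s\<bar> < \<epsilon>" for s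
    using \<epsilon>(2) that by (auto simp: subset_iff)
  have line: "((\<lambda>s. x + s *\<^sub>R b) has_derivative (\<lambda>s. s *\<^sub>R b)) (at s)" for s :: real
    by (auto intro!: derivative_eq_intros)
  have g: "((\<lambda>s. f (x + s *\<^sub>R b)) has_real_derivative D (x + s *\<^sub>R b) \<bullet> b) (at s)" if "\<bar>s\<bar> < \<epsilon>" for s
    unfolding has_field_derivative_def
    by (rule has_derivative_eq_rhs[OF has_derivative_compose[OF line D[OF inS[OF that]]]])
      (simp add: fun_eq_iff inner_commute)
  interpret H: bounded_linear H using H by (rule has_derivative_bounded_linear)
  have "((\<lambda>s. D (x + s *\<^sub>R b)) has_derivative (\<lambda>s. H (s *\<^sub>R b))) (at 0)"
    using has_derivative_compose[OF line[of 0], of D H] H by simp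
  then have "((\<lambda>s. D (x + s *\<^sub>R b) \<bullet> b) has_derivative (\<lambda>s. H (s *\<^sub>R b) \<bullet> b)) (at 0)"
    by (rule has_derivative_inner_left)
  then have G: "((\<lambda>s. D (x + s *\<^sub>R b) \<bullet> b) has_real_derivative H b \<bullet> b) (at 0)"
    unfolding has_field_derivative_def
    by (rule has_derivative_eq_rhs) (simp add: fun_eq_iff H.scaleR)
  have "D (x + 0 *\<^sub>R b) \<bullet> b = 0"
    by (rule DERIV_local_max[OF g[of 0] \<epsilon>(1)]) (use \<epsilon> in \<open>auto intro!: max inS\<close>)
  with DERIV_pos_inc_right[OF G pos] obtain \<delta> where
    \<delta>: "\<delta> > 0" "\<And>s. 0 < s \<Longrightarrow> s < \<delta> \<Longrightarrow> 0 < D (x + s *\<^sub>R b) \<bullet> b" by auto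
  define s where "s = min \<delta> \<epsilon> / 2"
  have s: "0 < s" "s < \<delta>" "s < \<epsilon>" using \<delta> \<epsilon> by (auto simp: s_def)
  have "f (x + 0 *\<^sub>R b) < f (x + s *\<^sub>R b)"
  proof (rule DERIV_pos_imp_increasing_open[OF s(1)])
    fix y :: real assume "0 < y" "y < s"
    then show "\<exists>l. ((\<lambda>s. f (x + s *\<^sub>R b)) has_real_derivative l) (at y) \<and> 0 < l"
      using g[of y] \<delta>(2)[of y] s by auto
  next
    show "continuous_on {0..s} (\<lambda>s. f (x + s *\<^sub>R b))"
      by (rule DERIV_continuous_on, rule has_field_derivative_at_within, rule g) (use s in auto)
  qed
  with max[OF inS[of s]] s show False by auto
qed

definition has_C2 :: "('a::euclidean_space \<Rightarrow> real) \<Rightarrow> ('a \<Rightarrow> 'a) \<Rightarrow> ('a \<Rightarrow> 'a \<Rightarrow> 'a) \<Rightarrow> bool" where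
  "has_C2 f D H \<longleftrightarrow> (\<forall>x. (f has_derivative (\<lambda>h. h \<bullet> D x)) (at x)) \<and>
     (\<forall>x. (D has_derivative H x) (at x)) \<and> (\<forall>v. continuous_on UNIV (\<lambda>x. H x v))"

lemma has_C2_continuous:
  assumes "has_C2 f D H"
  shows "continuous_on S f" "continuous_on S D" "continuous_on S (\<lambda>x. H x v)"
proof -
  show "continuous_on S f"
    by (rule has_derivative_continuous_on[where f' = "\<lambda>x h. h \<bullet> D x"])
      (use assms in \<open>simp add: has_C2_def has_derivative_at_withinI\<close>)
  show "continuous_on S D"
    by (rule has_derivative_continuous_on[where f' = H])
      (use assms in \<open>simp add: has_C2_def has_derivative_at_withinI\<close>)
  show "continuous_on S (\<lambda>x. H x v)"
    by (rule continuous_on_subset[OF _ subset_UNIV]) (use assms in \<open>simp add: has_C2_def\<close>)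
qed

lemma has_C2_const: "has_C2 (\<lambda>x. c) (\<lambda>x. 0) (\<lambda>x v. 0)"
  unfolding has_C2_def by auto

lemma has_C2_add:
  assumes "has_C2 f Df Hf" "has_C2 g Dg Hg"
  shows "has_C2 (\<lambda>x. f x + g x) (\<lambda>x. Df x + Dg x) (\<lambda>x v. Hf x v + Hg x v)"
  using assms unfolding has_C2_def
  by (auto intro!: derivative_eq_intros continuous_intros simp: inner_add_right)

lemma has_C2_sum:
  assumes "finite I" "\<And>i. i \<in> I \<Longrightarrow> has_C2 (f i) (D i) (H i)"
  shows "has_C2 (\<lambda>x. \<Sum>i\<in>I. f i x) (\<lambda>x. \<Sum>i\<in>I. D i x) (\<lambda>x v. \<Sum>i\<in>I. H i x v)"
  using assms by (induction I rule: finite_induct) (auto intro: has_C2_const has_C2_add)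

lemma has_C2_mult:
  assumes f: "has_C2 f Df Hf" and g: "has_C2 g Dg Hg"
  shows "has_C2 (\<lambda>x. f x * g x) (\<lambda>x. f x *\<^sub>R Dg x + g x *\<^sub>R Df x)
    (\<lambda>x v. f x *\<^sub>R Hg x v + (v \<bullet> Df x) *\<^sub>R Dg x + (g x *\<^sub>R Hf x v + (v \<bullet> Dg x) *\<^sub>R Df x))"
proof -
  show ?thesis unfolding has_C2_def
  proof (intro conjI allI)
    fix x v
    show "((\<lambda>x. f x * g x) has_derivative (\<lambda>h. h \<bullet> (f x *\<^sub>R Dg x + g x *\<^sub>R Df x))) (at x)"
      using f g unfolding has_C2_def
      by (auto intro!: derivative_eq_intros simp: inner_add_right)
    show "((\<lambda>x. f x *\<^sub>R Dg x + g x *\<^sub>R Df x) has_derivative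
       (\<lambda>v. f x *\<^sub>R Hg x v + (v \<bullet> Df x) *\<^sub>R Dg x + (g x *\<^sub>R Hf x v + (v \<bullet> Dg x) *\<^sub>R Df x))) (at x)"
      using f g unfolding has_C2_def
      by (intro has_derivative_add has_derivative_scaleR) auto
    show "continuous_on UNIV (\<lambda>x. f x *\<^sub>R Hg x v + (v \<bullet> Df x) *\<^sub>R Dg x + (g x *\<^sub>R Hf x v + (v \<bullet> Dg x) *\<^sub>R Df x))"
      by (intro continuous_on_add continuous_on_scaleR continuous_on_inner continuous_on_const
          has_C2_continuous[OF f] has_C2_continuous[OF g])
  qed
qed

lemma has_C2_compose:
  assumes f: "has_C2 f Df Hf"
    and k: "\<And>y. (k has_real_derivative k' y) (at y)" "\<And>y. (k' has_real_derivative k'' y) (at y)"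
      "continuous_on UNIV k''"
  shows "has_C2 (\<lambda>x. k (f x)) (\<lambda>x. k' (f x) *\<^sub>R Df x)
    (\<lambda>x v. k' (f x) *\<^sub>R Hf x v + (k'' (f x) * (v \<bullet> Df x)) *\<^sub>R Df x)"
proof -
  have "continuous_on UNIV k'" by (rule DERIV_continuous_on) (use k(2) in auto)
  then have c: "continuous_on UNIV (\<lambda>x. k' (f x))" "continuous_on UNIV (\<lambda>x. k'' (f x))"
    using continuous_on_compose2[OF _ has_C2_continuous(1)[OF f] subset_UNIV] k(3) by blast+
  have d: "((\<lambda>x. h (f x)) has_derivative (\<lambda>v. h' * (v \<bullet> Df x))) (at x)"
    if "(h has_real_derivative h') (at (f x))" for h h' x
    by (rule has_derivative_compose[of f _ x UNIV h "\<lambda>y. h' * y"])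
      (use that f in \<open>simp_all add: has_field_derivative_def has_C2_def\<close>)
  show ?thesis unfolding has_C2_def
  proof (intro conjI allI)
    fix x v
    show "((\<lambda>x. k (f x)) has_derivative (\<lambda>h. h \<bullet> k' (f x) *\<^sub>R Df x)) (at x)"
      using d[OF k(1)] by simp
    show "((\<lambda>x. k' (f x) *\<^sub>R Df x) has_derivative
       (\<lambda>v. k' (f x) *\<^sub>R Hf x v + (k'' (f x) * (v \<bullet> Df x)) *\<^sub>R Df x)) (at x)"
      by (rule has_derivative_scaleR[OF d[OF k(2)]]) (use f in \<open>auto simp: has_C2_def\<close>)
    show "continuous_on UNIV (\<lambda>x. k' (f x) *\<^sub>R Hf x v + (k'' (f x) * (v \<bullet> Df x)) *\<^sub>R Df x)"
      by (intro continuous_on_add continuous_on_scaleR continuous_on_mult continuous_on_inner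
          continuous_on_const c has_C2_continuous[OF f])
  qed
qed

lemma has_C2_norm_squared: "has_C2 (\<lambda>x. (norm (x - p))\<^sup>2) (\<lambda>x. 2 *\<^sub>R (x - p)) (\<lambda>x v. 2 *\<^sub>R v)"
  unfolding has_C2_def power2_norm_eq_inner
  by (auto intro!: derivative_eq_intros continuous_intros simp: inner_commute)

lemma DERIV_max_power:
  "((\<lambda>y::real. (max 0 y) ^ Suc (Suc n)) has_real_derivative real (Suc (Suc n)) * (max 0 y) ^ Suc n) (at y)"
proof -
  consider "y < 0" | "y = 0" | "y > 0" by linarith
  then show ?thesis
  proof cases
    case 1
    show ?thesis
      by (rule has_field_derivative_transform_within_open[where f = "\<lambda>_. 0" and S = "{..<0}"])
        (use 1 in \<open>auto simp: max_def\<close>)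
  next
    case 2
    show ?thesis unfolding CARAT_DERIV
    proof (intro exI[where x = "\<lambda>z. (max 0 z) ^ Suc n"] conjI allI)
      show "isCont (\<lambda>z. (max 0 z) ^ Suc n) y" by (intro continuous_intros)
    qed (use 2 in \<open>auto simp: max_def\<close>)
  next
    case 3
    show ?thesis
      by (rule has_field_derivative_transform_within_open[where f = "\<lambda>y. y ^ Suc (Suc n)" and S = "{0<..}"])
        (use 3 DERIV_pow[of "Suc (Suc n)" y UNIV] in \<open>auto simp: max_def\<close>)
  qed
qed

subsection \<open>Outward normals and a barrier\<close>

lemma defining_function_zero:
  fixes \<Omega> :: "'a::euclidean_space set" and \<phi> :: "'a \<Rightarrow> real"
  assumes "open \<Omega>" "p \<in> frontier \<Omega>" "isCont \<phi> p" "r > 0" "p \<in> ball q r"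
    and \<Omega>: "\<Omega> \<inter> ball q r = {x \<in> ball q r. \<phi> x < 0}"
  shows "\<phi> p = 0"
proof (rule antisym)
  have p: "p \<in> closure \<Omega>" "p \<notin> \<Omega>"
    using assms(1,2) by (auto simp: frontier_def interior_open)
  show "0 \<le> \<phi> p" using p \<Omega> assms by force
  show "\<phi> p \<le> 0"
  proof (rule ccontr)
    assume "\<not> \<phi> p \<le> 0"
    then have "\<forall>\<^sub>F x in nhds p. \<phi> x > 0"
      using \<open>isCont \<phi> p\<close> by (intro order_tendstoD(1)[of \<phi> "\<phi> p"]) (auto simp: isCont_def tendsto_at_iff_tendsto_nhds)
    moreover have "\<forall>\<^sub>F x in nhds p. x \<in> ball q r"
      using assms by (intro eventually_nhds_in_open) auto
    ultimately have "\<forall>\<^sub>F x in nhds p. x \<notin> \<Omega>"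
      by eventually_elim (use \<Omega> in force)
    then obtain U where "open U" "p \<in> U" "\<forall>x\<in>U. x \<notin> \<Omega>" by (auto simp: eventually_nhds)
    with p(1) show False by (meson closure_iff_nhds_not_empty disjoint_iff subset_refl)
  qed
qed

lemma outward_normal_side:
  fixes \<Omega> :: "'a::euclidean_space set"
  assumes "open \<Omega>" "p \<in> frontier \<Omega>" "outward_normal \<Omega> p g"
  obtains \<delta> where "\<delta> > 0" "\<And>s. 0 < s \<Longrightarrow> s < \<delta> \<Longrightarrow> v \<bullet> g < 0 \<Longrightarrow> p + s *\<^sub>R v \<in> \<Omega>"
    "\<And>s. 0 < s \<Longrightarrow> s < \<delta> \<Longrightarrow> v \<bullet> g > 0 \<Longrightarrow> p + s *\<^sub>R v \<notin> \<Omega>"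
proof -
  obtain \<phi> r where r: "r > 0" and \<phi>: "GDERIV \<phi> p :> g"
    and \<Omega>: "\<Omega> \<inter> ball p r = {x \<in> ball p r. \<phi> x < 0}"
    using assms(3) by (auto simp: outward_normal_def)
  have d: "(\<phi> has_derivative (\<lambda>h. h \<bullet> g)) (at p)" using \<phi> by (simp add: gderiv_def)
  have 0: "\<phi> p = 0"
    by (rule defining_function_zero[OF assms(1,2) _ r _ \<Omega>]) (use d r in \<open>auto intro: has_derivative_continuous\<close>)
  have line: "((\<lambda>s. p + s *\<^sub>R v) has_derivative (\<lambda>s. s *\<^sub>R v)) (at (0::real))"
    by (auto intro!: derivative_eq_intros)
  have G: "((\<lambda>s. \<phi> (p + s *\<^sub>R v)) has_real_derivative v \<bullet> g) (at 0)"
    unfolding has_field_derivative_def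
    by (rule has_derivative_eq_rhs[OF has_derivative_compose[OF line, of \<phi> "\<lambda>h. h \<bullet> g"]])
      (use d in \<open>auto simp: fun_eq_iff\<close>)
  obtain d1 where d1: "d1 > 0" "\<And>s. 0 < s \<Longrightarrow> s < d1 \<Longrightarrow> v \<bullet> g < 0 \<Longrightarrow> \<phi> (p + s *\<^sub>R v) < 0"
    using DERIV_neg_dec_right[OF G] 0 by (cases "v \<bullet> g < 0") (auto intro: that[of 1])
  obtain d2 where d2: "d2 > 0" "\<And>s. 0 < s \<Longrightarrow> s < d2 \<Longrightarrow> v \<bullet> g > 0 \<Longrightarrow> \<phi> (p + s *\<^sub>R v) > 0"
    using DERIV_pos_inc_right[OF G] 0 by (cases "v \<bullet> g > 0") (auto intro: that[of 1])
  define \<delta> where "\<delta> = min (min d1 d2) (r / (norm v + 1))"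
  have in_ball: "p + s *\<^sub>R v \<in> ball p r" if "0 < s" "s < \<delta>" for s
  proof -
    have "s * norm v \<le> s * (norm v + 1)" using that by simp
    also have "\<dots> < r" using that by (simp add: \<delta>_def pos_less_divide_eq add_nonneg_pos)
    finally show ?thesis using that by (simp add: dist_norm)
  qed
  show ?thesis
  proof (rule that[of \<delta>])
    show "\<delta> > 0" using d1 d2 r by (simp add: \<delta>_def add_nonneg_pos)
    fix s assume s: "0 < s" "s < \<delta>"
    then have "s < d1" "s < d2" by (auto simp: \<delta>_def)
    moreover have "p + s *\<^sub>R v \<in> \<Omega> \<longleftrightarrow> \<phi> (p + s *\<^sub>R v) < 0"
      using in_ball[OF s] \<Omega> by blast
    ultimately show "v \<bullet> g < 0 \<Longrightarrow> p + s *\<^sub>R v \<in> \<Omega>" "v \<bullet> g > 0 \<Longrightarrow> p + s *\<^sub>R v \<notin> \<Omega>"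
      using d1(2)[OF s(1)] d2(2)[OF s(1)] by fastforce+
  qed
qed

lemma outward_normals_inner_nonneg:
  fixes \<Omega> :: "'a::euclidean_space set"
  assumes "open \<Omega>" "p \<in> frontier \<Omega>" "outward_normal \<Omega> p a" "outward_normal \<Omega> p b"
  shows "a \<bullet> b \<ge> 0"
proof (rule ccontr)
  assume neg: "\<not> a \<bullet> b \<ge> 0"
  have a: "(- a) \<bullet> a < 0" using assms(3) by (simp add: outward_normal_def)
  obtain \<delta>1 where 1: "\<delta>1 > 0" "\<And>s. 0 < s \<Longrightarrow> s < \<delta>1 \<Longrightarrow> p + s *\<^sub>R (- a) \<in> \<Omega>"
    using outward_normal_side[OF assms(1-3), of "- a"] a by metis
  obtain \<delta>2 where 2: "\<delta>2 > 0" "\<And>s. 0 < s \<Longrightarrow> s < \<delta>2 \<Longrightarrow> p + s *\<^sub>R (- a) \<notin> \<Omega>"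
    using outward_normal_side[OF assms(1,2,4), of "- a"] neg
    by (metis inner_minus_left neg_0_less_iff_less not_le)
  define s where "s = min \<delta>1 \<delta>2 / 2"
  have "0 < s" "s < \<delta>1" "s < \<delta>2" using 1(1) 2(1) by (auto simp: s_def min_def)
  then show False using 1(2) 2(2) by blast
qed

text \<open>The field is the gradient of a cut-off times a local defining function. On the boundary the
  defining function vanishes, so only the term parallel to its gradient survives.\<close>

lemma local_normal_field:
  fixes \<Omega> :: "'a::euclidean_space set"
  assumes \<Omega>: "C2_domain \<Omega>" and p: "p \<in> frontier \<Omega>"
  shows "\<exists>f D H \<rho> L. has_C2 f D H \<and> \<rho> > 0 \<and> (\<forall>x. (\<Sum>b\<in>Basis. H x b \<bullet> b) \<le> L) \<and> (\<forall>x. - L \<le> f x) \<and>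
    (\<forall>q\<in>frontier \<Omega>. D q = 0 \<or> outward_normal \<Omega> q (D q)) \<and> (\<forall>q\<in>ball p \<rho>. M < norm (D q))"
proof -
  have "open \<Omega>" using \<Omega> by (simp add: C2_domain_def)
  obtain \<phi> :: "'a \<Rightarrow> real" and D\<phi> H\<phi> r where r: "r > 0"
    and \<phi>: "\<And>x. (\<phi> has_derivative (\<lambda>h. h \<bullet> D\<phi> x)) (at x)"
      "\<And>x. (D\<phi> has_derivative blinfun_apply (H\<phi> x)) (at x)"
      "continuous_on UNIV H\<phi>" "D\<phi> p \<noteq> 0"
    and loc: "\<Omega> \<inter> ball p r = {x \<in> ball p r. \<phi> x < 0}"
    using \<Omega> p unfolding C2_domain_def by meson
  have C2\<phi>: "has_C2 \<phi> D\<phi> (\<lambda>x. blinfun_apply (H\<phi> x))"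
    unfolding has_C2_def using \<phi> by (auto intro!: continuous_intros)
  define c where "c = (\<bar>M\<bar> + 1) / (r ^ 6 * norm (D\<phi> p))"
  have c: "c > 0" using r \<phi>(4) by (simp add: c_def add_nonneg_pos)
  define q where "q x = r\<^sup>2 + (- 1) * (norm (x - p))\<^sup>2" for x :: 'a
  define k where "k y = c * max 0 y ^ 3" for y :: real
  define k' where "k' y = c * (3 * max 0 y ^ 2)" for y :: real
  define k'' where "k'' y = c * (3 * (2 * max 0 y))" for y :: real
  have k: "(k has_real_derivative k' y) (at y)" "(k' has_real_derivative k'' y) (at y)" for y
    using DERIV_cmult[OF DERIV_max_power[of 1 y], of c]
      DERIV_cmult[OF DERIV_cmult[OF DERIV_max_power[of 0 y], of 3], of c]
    unfolding k_def k'_def k''_def by (simp_all add: eval_nat_numeral)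
  have "continuous_on UNIV k''" unfolding k''_def by (intro continuous_intros)
  note C2q = has_C2_add[OF has_C2_const[of "r\<^sup>2"] has_C2_mult[OF has_C2_const[of "-1"] has_C2_norm_squared[of p]],
      folded q_def]
  obtain D\<chi> H\<chi> where \<chi>: "has_C2 (\<lambda>x. k (q x)) D\<chi> H\<chi>" and D\<chi>: "\<And>x. q x \<le> 0 \<Longrightarrow> D\<chi> x = 0"
    using has_C2_compose[OF C2q k \<open>continuous_on UNIV k''\<close>] by (force simp: k'_def)
  have q_pos: "q x > 0 \<longleftrightarrow> x \<in> ball p r" for x
  proof -
    have "norm (x - p) < r \<longleftrightarrow> (norm (x - p))\<^sup>2 < r\<^sup>2"
      using r by (auto intro: power_strict_mono power2_less_imp_less)
    then show ?thesis by (simp add: q_def dist_norm norm_minus_commute)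
  qed
  have kq: "k (q x) = 0 \<longleftrightarrow> x \<notin> ball p r" "k (q x) \<ge> 0" for x
    using c q_pos[of x] by (auto simp: k_def max_def)
  define f where "f x = k (q x) * \<phi> x" for x
  define D where "D x = k (q x) *\<^sub>R D\<phi> x + \<phi> x *\<^sub>R D\<chi> x" for x
  obtain H where f: "has_C2 f D H"
    using has_C2_mult[OF \<chi> C2\<phi>] unfolding f_def[symmetric] D_def[symmetric] by blast
  have "compact ((\<lambda>x. \<Sum>b\<in>Basis. H x b \<bullet> b) ` cball p r)" "compact (f ` cball p r)"
    by (intro compact_continuous_image continuous_intros has_C2_continuous[OF f] compact_cball)+
  then have "bounded ((\<lambda>x. \<Sum>b\<in>Basis. H x b \<bullet> b) ` cball p r)" "bounded (f ` cball p r)"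
    by (auto intro: compact_imp_bounded)
  then have "\<exists>L. \<forall>x\<in>cball p r. \<bar>\<Sum>b\<in>Basis. H x b \<bullet> b\<bar> \<le> L" "\<exists>L. \<forall>x\<in>cball p r. \<bar>f x\<bar> \<le> L"
    unfolding bounded_iff ball_simps real_norm_def .
  then obtain L1 L2 where L1: "\<And>x. x \<in> cball p r \<Longrightarrow> \<bar>\<Sum>b\<in>Basis. H x b \<bullet> b\<bar> \<le> L1"
    and L2: "\<And>x. x \<in> cball p r \<Longrightarrow> \<bar>f x\<bar> \<le> L2" by blast
  have L0: "0 \<le> L1" "0 \<le> L2" using L1[of p] L2[of p] r by auto
  have f0: "f x = 0" if "x \<notin> cball p r" for x
    using kq(1)[of x] that by (auto simp: f_def)
  have tr: "(\<Sum>b\<in>Basis. H x b \<bullet> b) \<le> L1 + L2" for x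
  proof (cases "x \<in> cball p r")
    case False
    have "H x b \<bullet> b \<le> 0" for b
      by (rule second_derivative_nonpos_at_max[of "- cball p r" x f D])
        (use False f f0 in \<open>auto simp: has_C2_def\<close>)
    then show ?thesis using L0 by (smt (verit) sum_nonpos)
  qed (use L1[of x] L0 in auto)
  have fb: "- (L1 + L2) \<le> f x" for x
    using L2[of x] f0[of x] L0 by (cases "x \<in> cball p r") auto
  have D_frontier: "D q' = k (q q') *\<^sub>R D\<phi> q'" if "q' \<in> frontier \<Omega>" for q'
  proof (cases "q' \<in> ball p r")
    case True
    have "\<phi> q' = 0"
      by (rule defining_function_zero[OF \<open>open \<Omega>\<close> that _ r True loc]) (rule has_derivative_continuous[OF \<phi>(1)])
    then show ?thesis by (simp add: D_def)
  next
    case False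
    then show ?thesis using kq(1)[of q'] q_pos[of q'] D\<chi>[of q'] by (auto simp: D_def not_less)
  qed
  have normal: "D y = 0 \<or> outward_normal \<Omega> y (D y)" if y: "y \<in> frontier \<Omega>" for y
  proof (cases "D y = 0")
    case False
    then have "y \<in> ball p r" using D_frontier[OF y] kq(1)[of y] by auto
    then obtain s where s: "s > 0" "ball y s \<subseteq> ball p r"
      by (meson open_ball open_contains_ball)
    have "\<Omega> \<inter> ball y s = {x \<in> ball y s. f x < 0}"
    proof -
      have "x \<in> \<Omega> \<longleftrightarrow> f x < 0" if "x \<in> ball y s" for x
      proof -
        have "x \<in> ball p r" using s that by auto
        then have "x \<in> \<Omega> \<longleftrightarrow> \<phi> x < 0" "k (q x) > 0" using loc kq[of x] by force+
        then show ?thesis by (simp add: f_def mult_less_0_iff)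
      qed
      then show ?thesis by auto
    qed
    with False s f show ?thesis unfolding outward_normal_def gderiv_def has_C2_def by blast
  qed simp
  have "norm (D p) = \<bar>M\<bar> + 1"
    using D_frontier[OF p] r \<phi>(4) c by (simp add: k_def q_def c_def max_def power_mult[symmetric] abs_mult)
  moreover have "isCont (\<lambda>x. norm (D x)) p"
    using has_C2_continuous(2)[OF f, of UNIV]
    by (intro continuous_intros) (simp add: continuous_on_eq_continuous_at)
  then have "((\<lambda>x. norm (D x)) \<longlongrightarrow> norm (D p)) (nhds p)"
    unfolding isCont_def using tendsto_at_iff_tendsto_nhds[of "\<lambda>x. norm (D x)" p] by blast
  ultimately have "\<forall>\<^sub>F x in nhds p. M < norm (D x)"
    using order_tendstoD(1)[of "\<lambda>x. norm (D x)" "norm (D p)" "nhds p" M] by simp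
  then obtain \<rho> where "\<rho> > 0" "\<forall>x\<in>ball p \<rho>. M < norm (D x)"
    by (auto simp: eventually_nhds_metric dist_commute)
  with f tr fb normal show ?thesis by blast
qed

text \<open>In the maximum principle the quadratic growth forces maxima to be attained, and the strict
  normal derivative keeps them off the boundary. The local fields are made longer than the gradient
  of the quadratic term, which may point inwards.\<close>

lemma neumann_barrier:
  fixes \<Omega> :: "'a::euclidean_space set"
  assumes \<Omega>: "C2_domain \<Omega>" and "compact (frontier \<Omega>)"
  obtains h D H L where "has_C2 h D H" "\<And>x. (\<Sum>b\<in>Basis. H x b \<bullet> b) \<le> L"
    "\<And>x. (norm x)\<^sup>2 - L \<le> h x"
    "\<And>q. q \<in> frontier \<Omega> \<Longrightarrow> \<exists>g. outward_normal \<Omega> q g \<and> D q \<bullet> g > 0"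
proof -
  have "open \<Omega>" using \<Omega> by (simp add: C2_domain_def)
  obtain R where R: "\<And>q. q \<in> frontier \<Omega> \<Longrightarrow> norm q \<le> R"
    using compact_imp_bounded[OF assms(2)] by (auto simp: bounded_iff)
  define Q where "Q p f D H \<rho> L \<longleftrightarrow> has_C2 f D H \<and> \<rho> > 0 \<and> (\<forall>x. (\<Sum>b\<in>Basis. H x b \<bullet> b) \<le> L) \<and>
     (\<forall>x. - L \<le> f x) \<and> (\<forall>q\<in>frontier \<Omega>. D q = 0 \<or> outward_normal \<Omega> q (D q)) \<and>
     (\<forall>q\<in>ball p \<rho>. 2 * \<bar>R\<bar> < norm (D q))" for p f D H and \<rho> L :: real
  have "\<forall>p. \<exists>f D H \<rho> L. p \<in> frontier \<Omega> \<longrightarrow> Q p f D H \<rho> L"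
    using local_normal_field[OF \<Omega>, of _ "2 * \<bar>R\<bar>"] unfolding Q_def by blast
  then obtain f D H \<rho> L where "\<And>p. p \<in> frontier \<Omega> \<Longrightarrow> Q p (f p) (D p) (H p) (\<rho> p) (L p)"
    by metis
  note loc = this[unfolded Q_def]
  have cover: "frontier \<Omega> \<subseteq> (\<Union>p\<in>frontier \<Omega>. ball p (\<rho> p))"
    using loc by (auto intro!: bexI)
  obtain P where P: "P \<subseteq> frontier \<Omega>" "finite P" "frontier \<Omega> \<subseteq> (\<Union>p\<in>P. ball p (\<rho> p))"
    by (rule compactE_image[OF assms(2) _ cover]) auto
  define h where "h x = (norm (x - 0))\<^sup>2 + (\<Sum>p\<in>P. f p x)" for x
  define Dh where "Dh x = 2 *\<^sub>R (x - 0) + (\<Sum>p\<in>P. D p x)" for x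
  define Hh where "Hh x v = 2 *\<^sub>R v + (\<Sum>p\<in>P. H p x v)" for x v
  define L' where "L' = \<bar>2 * real DIM('a)\<bar> + \<bar>\<Sum>p\<in>P. L p\<bar>"
  show ?thesis
  proof (rule that[of h Dh Hh L'])
    show "has_C2 h Dh Hh"
      unfolding h_def Dh_def Hh_def using P loc by (intro has_C2_add has_C2_norm_squared has_C2_sum) auto
    fix x
    have "(\<Sum>b\<in>Basis. Hh x b \<bullet> b) = 2 * real DIM('a) + (\<Sum>p\<in>P. \<Sum>b\<in>Basis. H p x b \<bullet> b)"
      by (simp add: Hh_def inner_add_left sum.distrib inner_sum_left sum.swap[of _ P])
    also have "(\<Sum>p\<in>P. \<Sum>b\<in>Basis. H p x b \<bullet> b) \<le> (\<Sum>p\<in>P. L p)"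
      using P loc by (intro sum_mono) auto
    finally show "(\<Sum>b\<in>Basis. Hh x b \<bullet> b) \<le> L'" by (simp add: L'_def)
    have "(\<Sum>p\<in>P. - L p) \<le> (\<Sum>p\<in>P. f p x)" using P loc by (intro sum_mono) auto
    then show "(norm x)\<^sup>2 - L' \<le> h x" by (simp add: h_def L'_def sum_negf)
  next
    fix q assume q: "q \<in> frontier \<Omega>"
    then obtain p where p: "p \<in> P" "q \<in> ball p (\<rho> p)" using P by auto
    define g where "g = D p q"
    have g: "2 * \<bar>R\<bar> < norm g" using p P loc by (auto simp: g_def)
    then have "g \<noteq> 0" by auto
    then have out: "outward_normal \<Omega> q g" using p P loc q by (auto simp: g_def)
    have "0 \<le> (\<Sum>p'\<in>P - {p}. D p' q \<bullet> g)"
    proof (rule sum_nonneg)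
      fix p' assume "p' \<in> P - {p}"
      then have "D p' q = 0 \<or> outward_normal \<Omega> q (D p' q)" using P loc q by auto
      then show "0 \<le> D p' q \<bullet> g" using outward_normals_inner_nonneg[OF \<open>open \<Omega>\<close> q _ out] by auto
    qed
    moreover have "Dh q \<bullet> g = 2 * (q \<bullet> g) + (g \<bullet> g + (\<Sum>p'\<in>P - {p}. D p' q \<bullet> g))"
      using P p by (simp add: Dh_def inner_add_left inner_sum_left sum.remove[of P p] g_def)
    moreover have "\<bar>q \<bullet> g\<bar> \<le> norm q * norm g" by (rule Cauchy_Schwarz_ineq2)
    moreover have "norm q * norm g \<le> \<bar>R\<bar> * norm g" using R[OF q] by (intro mult_right_mono) auto
    moreover have "2 * \<bar>R\<bar> * norm g < g \<bullet> g"
      using g \<open>g \<noteq> 0\<close> by (simp add: dot_square_norm power2_eq_square)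
    ultimately have "Dh q \<bullet> g > 0" by linarith
    with out show "\<exists>g. outward_normal \<Omega> q g \<and> Dh q \<bullet> g > 0" by blast
  qed
qed

subsection \<open>Maximum principle\<close>

lemma maximum_principle:
  fixes \<Omega> :: "'a::euclidean_space set" and w :: "real \<Rightarrow> 'a \<Rightarrow> real"
  assumes \<Omega>: "C2_domain \<Omega>" "compact (frontier \<Omega>)" and d: "d \<ge> 0"
    and cont: "continuous_on ({0..} \<times> closure \<Omega>) (\<lambda>(t, x). w t x)"
    and bound: "\<And>t x. t \<ge> 0 \<Longrightarrow> x \<in> closure \<Omega> \<Longrightarrow> w t x \<le> M"
    and init: "\<And>x. x \<in> closure \<Omega> \<Longrightarrow> w 0 x \<le> 0"
    and interior: "\<And>t x. t > 0 \<Longrightarrow> x \<in> \<Omega> \<Longrightarrow> w t x > 0 \<Longrightarrow>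
      \<exists>Wt Dw Hw. ((\<lambda>s. w s x) has_real_derivative Wt) (at t) \<and>
        (\<forall>y\<in>\<Omega>. (w t has_derivative (\<lambda>h. h \<bullet> Dw y)) (at y)) \<and> (Dw has_derivative Hw) (at x) \<and>
        Wt \<le> d * (\<Sum>b\<in>Basis. Hw b \<bullet> b) + B * w t x"
    and boundary: "\<And>t p g. t > 0 \<Longrightarrow> p \<in> frontier \<Omega> \<Longrightarrow> w t p > 0 \<Longrightarrow> outward_normal \<Omega> p g \<Longrightarrow>
      \<exists>D. (w t has_derivative (\<lambda>h. h \<bullet> D)) (at p within closure \<Omega>) \<and> D \<bullet> g \<le> 0"
    and "t\<^sub>1 \<ge> 0" "x\<^sub>1 \<in> closure \<Omega>"
  shows "w t\<^sub>1 x\<^sub>1 \<le> 0"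
proof (rule ccontr)
  assume "\<not> w t\<^sub>1 x\<^sub>1 \<le> 0"
  then have w1: "w t\<^sub>1 x\<^sub>1 > 0" by simp
  have "open \<Omega>" using \<Omega> by (simp add: C2_domain_def)
  obtain h D H L where h: "has_C2 h D H" "\<And>x. (\<Sum>b\<in>Basis. H x b \<bullet> b) \<le> L"
    "\<And>x. (norm x)\<^sup>2 - L \<le> h x"
    "\<And>q. q \<in> frontier \<Omega> \<Longrightarrow> \<exists>g. outward_normal \<Omega> q g \<and> D q \<bullet> g > 0"
    using neumann_barrier[OF \<Omega>] by blast
  define \<beta> where "\<beta> = d * \<bar>L\<bar> + 1"
  have \<beta>: "\<beta> > 0" using d by (simp add: \<beta>_def add_nonneg_pos)
  define k where "k t x = h x + \<bar>L\<bar> + \<beta> * t" for t x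
  have k: "(norm x)\<^sup>2 \<le> k t x" if "t \<ge> 0" for t x
  proof -
    have "0 \<le> \<beta> * t" using that \<beta> by simp
    then show ?thesis using h(3)[of x] unfolding k_def by linarith
  qed
  then have k0: "0 \<le> k t x" if "t \<ge> 0" for t x
    using that order_trans[OF zero_le_power2] by blast
  define \<epsilon> where "\<epsilon> = exp (- B * t\<^sub>1) * w t\<^sub>1 x\<^sub>1 / (2 * (k t\<^sub>1 x\<^sub>1 + 1))"
  have \<epsilon>: "\<epsilon> > 0" using w1 k0[of t\<^sub>1 x\<^sub>1] \<open>t\<^sub>1 \<ge> 0\<close> by (simp add: \<epsilon>_def add_nonneg_pos)
  define f where "f t x = exp (- B * t) * w t x - \<epsilon> * k t x" for t x
  have f1: "f t\<^sub>1 x\<^sub>1 > 0"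
  proof -
    have "\<epsilon> * (2 * (k t\<^sub>1 x\<^sub>1 + 1)) = exp (- B * t\<^sub>1) * w t\<^sub>1 x\<^sub>1"
      using k0[of t\<^sub>1 x\<^sub>1] \<open>t\<^sub>1 \<ge> 0\<close> by (simp add: \<epsilon>_def)
    moreover have "0 \<le> \<epsilon> * k t\<^sub>1 x\<^sub>1" using \<epsilon> k0 \<open>t\<^sub>1 \<ge> 0\<close> by simp
    ultimately show ?thesis using \<epsilon> by (simp add: f_def algebra_simps)
  qed
  define \<rho> where "\<rho> = exp (\<bar>B\<bar> * t\<^sub>1) * \<bar>M\<bar> / \<epsilon> + 1"
  have \<rho>: "\<rho> \<ge> 1" using \<epsilon> by (simp add: \<rho>_def)
  have small: "norm x \<le> \<rho>" if "0 \<le> t" "t \<le> t\<^sub>1" "x \<in> closure \<Omega>" "f t x > 0" for t x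
  proof -
    have "- B * t \<le> \<bar>B\<bar> * t\<^sub>1" using that by (intro mult_mono) auto
    then have "exp (- B * t) * w t x \<le> exp (\<bar>B\<bar> * t\<^sub>1) * \<bar>M\<bar>"
      using bound[OF that(1,3)] by (intro order_trans[OF mult_left_mono[of "w t x" "\<bar>M\<bar>"]] mult_right_mono) auto
    moreover have "\<epsilon> * (norm x)\<^sup>2 \<le> \<epsilon> * k t x" using k[OF that(1)] \<epsilon> by simp
    ultimately have "\<epsilon> * (norm x)\<^sup>2 < exp (\<bar>B\<bar> * t\<^sub>1) * \<bar>M\<bar>" using that(4) by (simp add: f_def)
    then have "(norm x)\<^sup>2 \<le> \<rho>" using \<epsilon> by (simp add: \<rho>_def field_simps)
    also have "\<dots> \<le> \<rho>\<^sup>2" using \<rho> by (simp add: power2_eq_square)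
    finally show ?thesis by (rule power2_le_imp_le) (use \<rho> in auto)
  qed
  have cf: "continuous_on ({0..t\<^sub>1} \<times> (closure \<Omega> \<inter> cball 0 \<rho>)) (\<lambda>z. f (fst z) (snd z))"
  proof -
    have "continuous_on ({0..t\<^sub>1} \<times> (closure \<Omega> \<inter> cball 0 \<rho>)) (\<lambda>z. w (fst z) (snd z))"
      by (rule continuous_on_subset[OF cont[unfolded case_prod_beta]]) auto
    moreover have "continuous_on S (\<lambda>z. h (snd z))" for S :: "(real \<times> 'a) set"
      by (rule continuous_on_compose2[OF has_C2_continuous(1)[OF h(1)]]) (auto intro: continuous_intros)
    ultimately show ?thesis unfolding f_def k_def by (intro continuous_intros)
  qed
  have "compact ({0..t\<^sub>1} \<times> (closure \<Omega> \<inter> cball 0 \<rho>))"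
    by (intro compact_Times compact_Icc closed_Int_compact closed_closure compact_cball)
  moreover have mem1: "(t\<^sub>1, x\<^sub>1) \<in> {0..t\<^sub>1} \<times> (closure \<Omega> \<inter> cball 0 \<rho>)"
    using assms(9,10) small[OF _ _ _ f1] by auto
  ultimately obtain z where z: "z \<in> {0..t\<^sub>1} \<times> (closure \<Omega> \<inter> cball 0 \<rho>)"
    "\<And>y. y \<in> {0..t\<^sub>1} \<times> (closure \<Omega> \<inter> cball 0 \<rho>) \<Longrightarrow> f (fst y) (snd y) \<le> f (fst z) (snd z)"
    using continuous_attains_sup[OF _ _ cf] by blast
  obtain t x where tx: "z = (t, x)" by (cases z)
  have t: "0 \<le> t" "t \<le> t\<^sub>1" and x: "x \<in> closure \<Omega>" using z(1) tx by auto
  have fpos: "f t x > 0" using z(2)[OF mem1] f1 tx by simp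
  have fmax: "f s y \<le> f t x" if "0 \<le> s" "s \<le> t\<^sub>1" "y \<in> closure \<Omega>" for s y
  proof (cases "f s y > 0")
    case True
    then show ?thesis using z(2)[of "(s, y)"] small[OF that] that tx by auto
  qed (use fpos in auto)
  have wpos: "w t x > 0"
  proof -
    have "0 < exp (- B * t) * w t x"
      using fpos mult_nonneg_nonneg[OF less_imp_le[OF \<epsilon>] k0[OF t(1), of x]] by (simp add: f_def)
    then show ?thesis by (simp add: zero_less_mult_iff)
  qed
  then have tpos: "t > 0" using init[OF x] t(1) by (cases "t = 0") auto
  have Dh: "(h has_derivative (\<lambda>v. v \<bullet> D y)) (at y within S)" for y S
    using h(1) by (auto simp: has_C2_def intro: has_derivative_at_withinI)
  show False
  proof (cases "x \<in> \<Omega>")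
    case True
    obtain Wt Dw Hw where W: "((\<lambda>s. w s x) has_real_derivative Wt) (at t)"
      "\<And>y. y \<in> \<Omega> \<Longrightarrow> (w t has_derivative (\<lambda>h. h \<bullet> Dw y)) (at y)" "(Dw has_derivative Hw) (at x)"
      "Wt \<le> d * (\<Sum>b\<in>Basis. Hw b \<bullet> b) + B * w t x"
      using interior[OF tpos True wpos] by blast
    have "exp (- B * t) * (Hw b \<bullet> b) \<le> \<epsilon> * (H x b \<bullet> b)" for b
    proof -
      have "(exp (- B * t) *\<^sub>R Hw b - \<epsilon> *\<^sub>R H x b) \<bullet> b \<le> 0"
      proof (rule second_derivative_nonpos_at_max[OF \<open>open \<Omega>\<close> True, where f = "f t"
            and D = "\<lambda>y. exp (- B * t) *\<^sub>R Dw y - \<epsilon> *\<^sub>R D y"])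
        show "(f t has_derivative (\<lambda>h. h \<bullet> (exp (- B * t) *\<^sub>R Dw y - \<epsilon> *\<^sub>R D y))) (at y)"
          if "y \<in> \<Omega>" for y
          unfolding f_def k_def
          by (auto intro!: derivative_eq_intros W(2)[OF that] Dh simp: inner_diff_right)
        show "((\<lambda>y. exp (- B * t) *\<^sub>R Dw y - \<epsilon> *\<^sub>R D y) has_derivative
            (\<lambda>v. exp (- B * t) *\<^sub>R Hw v - \<epsilon> *\<^sub>R H x v)) (at x)"
          by (intro has_derivative_diff has_derivative_scaleR_right W(3)) (use h(1) in \<open>auto simp: has_C2_def\<close>)
        show "f t y \<le> f t x" if "y \<in> \<Omega>" for y
          using fmax[OF t, of y] that closure_subset by auto
      qed
      then show ?thesis by (simp add: inner_diff_left)
    qed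
    then have "exp (- B * t) * (\<Sum>b\<in>Basis. Hw b \<bullet> b) \<le> \<epsilon> * (\<Sum>b\<in>Basis. H x b \<bullet> b)"
      unfolding sum_distrib_left by (intro sum_mono)
    also have "\<dots> \<le> \<epsilon> * \<bar>L\<bar>" using h(2)[of x] \<epsilon> by (intro mult_left_mono) auto
    finally have tr: "d * (exp (- B * t) * (\<Sum>b\<in>Basis. Hw b \<bullet> b)) \<le> d * (\<epsilon> * \<bar>L\<bar>)"
      using d by (rule mult_left_mono)
    have ft: "((\<lambda>s. f s x) has_real_derivative exp (- B * t) * (Wt - B * w t x) - \<epsilon> * \<beta>) (at t)"
      unfolding f_def k_def by (auto intro!: derivative_eq_intros W(1) simp: algebra_simps)
    have "\<not> exp (- B * t) * (Wt - B * w t x) - \<epsilon> * \<beta> < 0"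
    proof
      assume "exp (- B * t) * (Wt - B * w t x) - \<epsilon> * \<beta> < 0"
      from DERIV_neg_dec_left[OF ft this] obtain \<delta> where
        \<delta>: "\<delta> > 0" "\<And>h. h > 0 \<Longrightarrow> h < \<delta> \<Longrightarrow> f t x < f (t - h) x" by auto
      define s where "s = min \<delta> t / 2"
      have "0 < s" "s < \<delta>" "s < t" using \<delta> tpos by (auto simp: s_def min_def)
      then show False using \<delta>(2)[of s] fmax[of "t - s" x] t x by auto
    qed
    moreover have "exp (- B * t) * (Wt - B * w t x) \<le> exp (- B * t) * (d * (\<Sum>b\<in>Basis. Hw b \<bullet> b))"
      using W(4) by (intro mult_left_mono) auto
    moreover have "d * (\<epsilon> * \<bar>L\<bar>) < \<epsilon> * \<beta>" using \<epsilon> by (simp add: \<beta>_def algebra_simps)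
    ultimately show False using tr by (simp add: algebra_simps)
  next
    case False
    then have xf: "x \<in> frontier \<Omega>" using x \<open>open \<Omega>\<close> by (simp add: frontier_def interior_open)
    obtain g where g: "outward_normal \<Omega> x g" "D x \<bullet> g > 0" using h(4)[OF xf] by blast
    obtain Dw where Dw: "(w t has_derivative (\<lambda>h. h \<bullet> Dw)) (at x within closure \<Omega>)" "Dw \<bullet> g \<le> 0"
      using boundary[OF tpos xf wpos g(1)] by blast
    define E where "E = exp (- B * t) *\<^sub>R Dw - \<epsilon> *\<^sub>R D x"
    have fE: "(f t has_derivative (\<lambda>h. h \<bullet> E)) (at x within closure \<Omega>)"
      unfolding f_def k_def E_def
      by (auto intro!: derivative_eq_intros Dw Dh simp: inner_diff_right)
    have "(- g) \<bullet> g < 0" using g(1) by (simp add: outward_normal_def)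
    then obtain \<delta> where \<delta>: "\<delta> > 0" "\<And>s. 0 < s \<Longrightarrow> s < \<delta> \<Longrightarrow> x + s *\<^sub>R (- g) \<in> \<Omega>"
      using outward_normal_side[OF \<open>open \<Omega>\<close> xf g(1), of "- g"] by metis
    have seg: "(\<lambda>s. x + s *\<^sub>R (- g)) ` {0..<\<delta>} \<subseteq> closure \<Omega>"
    proof (rule image_subsetI)
      fix s assume "s \<in> {0..<\<delta>}"
      then show "x + s *\<^sub>R (- g) \<in> closure \<Omega>"
        using x \<delta>(2)[of s] closure_subset by (cases "s = 0") auto
    qed
    have line: "((\<lambda>s. x + s *\<^sub>R (- g)) has_derivative (\<lambda>s. s *\<^sub>R (- g))) (at (0::real) within {0..<\<delta>})"
      by (auto intro!: derivative_eq_intros)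
    have "((\<lambda>s. f t (x + s *\<^sub>R (- g))) has_derivative (\<lambda>s. (s *\<^sub>R (- g)) \<bullet> E)) (at 0 within {0..<\<delta>})"
      by (rule has_derivative_in_compose[OF line])
        (use has_derivative_subset[OF fE seg] in simp)
    then have "((\<lambda>s. f t (x + s *\<^sub>R (- g))) has_real_derivative (- g) \<bullet> E) (at 0 within {0..<\<delta>})"
      unfolding has_field_derivative_def by (rule has_derivative_eq_rhs) (simp add: fun_eq_iff)
    moreover have "(- g) \<bullet> E > 0"
    proof -
      have "exp (- B * t) * (Dw \<bullet> g) \<le> 0" using Dw(2) by (simp add: mult_nonneg_nonpos)
      moreover have "0 < \<epsilon> * (D x \<bullet> g)" using g \<epsilon> by simp
      ultimately show ?thesis by (simp add: E_def inner_diff_right inner_commute)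
    qed
    ultimately obtain \<eta> where \<eta>: "\<eta> > 0"
      "\<And>s. s > 0 \<Longrightarrow> s \<in> {0..<\<delta>} \<Longrightarrow> s < \<eta> \<Longrightarrow> f t x < f t (x + s *\<^sub>R (- g))"
      using has_real_derivative_pos_inc_right[of "\<lambda>s. f t (x + s *\<^sub>R (- g))" "(- g) \<bullet> E" 0 "{0..<\<delta>}"] by auto
    define s where "s = min \<delta> \<eta> / 2"
    have s: "0 < s" "s < \<delta>" "s < \<eta>" using \<delta> \<eta> by (auto simp: s_def min_def)
    then have "x + s *\<^sub>R (- g) \<in> closure \<Omega>" using seg by (simp add: image_subset_iff)
    then show False
      using \<eta>(2)[of s] fmax[OF t, of "x + s *\<^sub>R (- g)"] s by simp
  qed
qed

lemma exponential_comparison: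
  fixes \<Omega> :: "'a::euclidean_space set" and w :: "real \<Rightarrow> 'a \<Rightarrow> real"
  assumes \<Omega>: "C2_domain \<Omega>" "compact (frontier \<Omega>)" and d: "d \<ge> 0"
    and cont: "continuous_on ({0..} \<times> closure \<Omega>) (\<lambda>(t, x). w t x)"
    and bdd: "bounded ((\<lambda>(t, x). w t x) ` ({0..} \<times> closure \<Omega>))"
    and sol: "reaction_diffusion_sol \<Omega> d F w"
    and e: "norm e = 1"
    and W: "\<And>t x. W t x = \<sigma> * w t x + \<alpha> - \<beta> * exp (- \<kappa> * (x \<bullet> e - R - c * t))"
    and \<beta>: "\<beta> \<ge> 0"
    and init: "\<And>x. x \<in> closure \<Omega> \<Longrightarrow> W 0 x \<le> 0"
    and interior: "\<And>t x. t > 0 \<Longrightarrow> x \<in> \<Omega> \<Longrightarrow> W t x > 0 \<Longrightarrow>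
      \<sigma> * F t x \<le> \<beta> * (\<kappa> * (c - d * \<kappa>)) * exp (- \<kappa> * (x \<bullet> e - R - c * t)) + B * W t x"
    and boundary: "\<And>t x. t > 0 \<Longrightarrow> x \<in> frontier \<Omega> \<Longrightarrow> \<beta> \<noteq> 0 \<Longrightarrow> W t x \<le> 0"
    and "t \<ge> 0" "x \<in> closure \<Omega>"
  shows "W t x \<le> 0"
proof -
  define E where "E t x = exp (- \<kappa> * (x \<bullet> e - R - c * t))" for t and x :: 'a
  obtain Wt Dw Hw where S: "\<And>t x. t > 0 \<Longrightarrow> x \<in> closure \<Omega> \<Longrightarrow> ((\<lambda>s. w s x) has_real_derivative Wt t x) (at t)"
    "\<And>t x. t > 0 \<Longrightarrow> x \<in> closure \<Omega> \<Longrightarrow> (w t has_derivative (\<lambda>h. h \<bullet> Dw t x)) (at x within closure \<Omega>)"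
    "\<And>t x. t > 0 \<Longrightarrow> x \<in> \<Omega> \<Longrightarrow> (Dw t has_derivative blinfun_apply (Hw t x)) (at x)"
    "\<And>t x. t > 0 \<Longrightarrow> x \<in> \<Omega> \<Longrightarrow> Wt t x = d * (\<Sum>b\<in>Basis. blinfun_apply (Hw t x) b \<bullet> b) + F t x"
    "\<And>t p g. t > 0 \<Longrightarrow> p \<in> frontier \<Omega> \<Longrightarrow> outward_normal \<Omega> p g \<Longrightarrow> Dw t p \<bullet> g = 0"
    using sol unfolding reaction_diffusion_sol_def by blast
  have "open \<Omega>" using \<Omega> by (simp add: C2_domain_def)
  obtain M where M: "\<And>t x. t \<ge> 0 \<Longrightarrow> x \<in> closure \<Omega> \<Longrightarrow> \<bar>w t x\<bar> \<le> M"
    using bdd by (force simp: bounded_iff)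
  have We: "W = (\<lambda>t x. \<sigma> * w t x + \<alpha> - \<beta> * E t x)" using W by (auto simp: E_def fun_eq_iff)
  have Et: "((\<lambda>t. E t x) has_real_derivative \<kappa> * c * E t x) (at t)" for t x
    unfolding E_def by (auto intro!: derivative_eq_intros)
  have Ex: "(E t has_derivative (\<lambda>h. - \<kappa> * (h \<bullet> e) * E t x)) (at x within S)" for t x S
    unfolding E_def by (auto intro!: derivative_eq_intros)
  have trE: "(\<Sum>b\<in>Basis. ((b \<bullet> e) *\<^sub>R e) \<bullet> b) = 1"
  proof -
    have "(\<Sum>b\<in>Basis. ((b \<bullet> e) *\<^sub>R e) \<bullet> b) = e \<bullet> e"
      by (subst euclidean_inner[of e e]) (simp add: inner_commute)
    then show ?thesis using e by (simp add: dot_square_norm)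
  qed
  show ?thesis
  proof (rule maximum_principle[OF \<Omega> d, where w = W and M = "\<bar>\<sigma>\<bar> * M + \<bar>\<alpha>\<bar>" and B = B])
    have "continuous_on ({0..} \<times> closure \<Omega>) (\<lambda>z. w (fst z) (snd z))"
      using cont by (simp add: case_prod_beta)
    then show "continuous_on ({0..} \<times> closure \<Omega>) (\<lambda>(t, x). W t x)"
      unfolding case_prod_beta W by (intro continuous_intros)
  next
    fix t x assume tx: "(t::real) \<ge> 0" "x \<in> closure \<Omega>"
    have "\<sigma> * w t x \<le> \<bar>\<sigma>\<bar> * \<bar>w t x\<bar>" by (metis abs_ge_self abs_mult)
    also have "\<dots> \<le> \<bar>\<sigma>\<bar> * M" using M[OF tx] by (intro mult_left_mono) auto
    finally have "\<sigma> * w t x \<le> \<bar>\<sigma>\<bar> * M" .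
    moreover have "0 \<le> \<beta> * exp (- \<kappa> * (x \<bullet> e - R - c * t))" using \<beta> by simp
    moreover have "\<alpha> \<le> \<bar>\<alpha>\<bar>" by simp
    ultimately show "W t x \<le> \<bar>\<sigma>\<bar> * M + \<bar>\<alpha>\<bar>" unfolding W by linarith
  next
    fix t x assume tx: "(t::real) > 0" "x \<in> \<Omega>" "W t x > 0"
    then have xc: "x \<in> closure \<Omega>" using closure_subset by blast
    define D where "D y = \<sigma> *\<^sub>R Dw t y + (\<beta> * \<kappa> * E t y) *\<^sub>R e" for y
    define H where "H v = \<sigma> *\<^sub>R blinfun_apply (Hw t x) v - (\<beta> * \<kappa> * \<kappa> * E t x) *\<^sub>R ((v \<bullet> e) *\<^sub>R e)" for v
    have 1: "((\<lambda>s. W s x) has_real_derivative \<sigma> * Wt t x - \<beta> * (\<kappa> * c * E t x)) (at t)"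
      unfolding We by (auto intro!: derivative_eq_intros S(1)[OF tx(1) xc] Et)
    have 2: "(W t has_derivative (\<lambda>h. h \<bullet> D y)) (at y)" if "y \<in> \<Omega>" for y
    proof -
      have "(w t has_derivative (\<lambda>h. h \<bullet> Dw t y)) (at y within \<Omega>)"
        using S(2)[OF tx(1), of y] that closure_subset by (blast intro: has_derivative_subset)
      then have "(w t has_derivative (\<lambda>h. h \<bullet> Dw t y)) (at y)"
        using at_within_open[OF that \<open>open \<Omega>\<close>] by simp
      then show ?thesis unfolding We D_def
        by (auto intro!: derivative_eq_intros Ex simp: inner_add_right algebra_simps)
    qed
    have 3: "(D has_derivative H) (at x)"
      unfolding D_def H_def
      by (auto intro!: derivative_eq_intros Ex S(3)[OF tx(1,2)] simp: fun_eq_iff algebra_simps)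
    have "(\<Sum>b\<in>Basis. H b \<bullet> b) = \<sigma> * (\<Sum>b\<in>Basis. blinfun_apply (Hw t x) b \<bullet> b) -
        (\<beta> * \<kappa> * \<kappa> * E t x) * (\<Sum>b\<in>Basis. ((b \<bullet> e) *\<^sub>R e) \<bullet> b)"
      by (simp add: H_def inner_diff_left sum_subtractf sum_distrib_left mult.assoc)
    then have trH: "(\<Sum>b\<in>Basis. H b \<bullet> b) =
        \<sigma> * (\<Sum>b\<in>Basis. blinfun_apply (Hw t x) b \<bullet> b) - \<beta> * \<kappa> * \<kappa> * E t x"
      unfolding trE by simp
    have "\<sigma> * Wt t x - \<beta> * (\<kappa> * c * E t x) \<le> d * (\<Sum>b\<in>Basis. H b \<bullet> b) + B * W t x"
      using interior[OF tx] unfolding trH S(4)[OF tx(1,2)] E_def[symmetric] by (simp add: algebra_simps)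
    with 1 2 3 show "\<exists>Wt Dw Hw. ((\<lambda>s. W s x) has_real_derivative Wt) (at t) \<and>
        (\<forall>y\<in>\<Omega>. (W t has_derivative (\<lambda>h. h \<bullet> Dw y)) (at y)) \<and> (Dw has_derivative Hw) (at x) \<and>
        Wt \<le> d * (\<Sum>b\<in>Basis. Hw b \<bullet> b) + B * W t x" by blast
  next
    fix t p g assume *: "(t::real) > 0" "p \<in> frontier \<Omega>" "W t p > 0" "outward_normal \<Omega> p g"
    have "\<beta> = 0" using boundary[OF *(1,2)] *(3) by fastforce
    moreover have "p \<in> closure \<Omega>" using *(2) by (simp add: frontier_def)
    ultimately have "(W t has_derivative (\<lambda>h. h \<bullet> \<sigma> *\<^sub>R Dw t p)) (at p within closure \<Omega>)"
      unfolding We by (auto intro!: derivative_eq_intros S(2)[OF *(1)])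
    then show "\<exists>D. (W t has_derivative (\<lambda>h. h \<bullet> D)) (at p within closure \<Omega>) \<and> D \<bullet> g \<le> 0"
      using S(5)[OF *(1,2,4)] by (intro exI[of _ "\<sigma> *\<^sub>R Dw t p"]) auto
  qed (use init assms in auto)
qed

subsection \<open>Elementary properties of the speeds\<close>

lemma exterior_domain_contains_ray:
  fixes \<Omega> :: "'a::euclidean_space set"
  assumes "exterior_domain \<Omega>" "norm e = 1"
  obtains s\<^sub>0 where "\<And>s. s \<ge> s\<^sub>0 \<Longrightarrow> z + s *\<^sub>R e \<in> \<Omega>"
proof -
  obtain R where R: "\<And>x. x \<notin> \<Omega> \<Longrightarrow> norm x \<le> R"
    using assms(1) compact_imp_bounded[of "- \<Omega>"] by (auto simp: exterior_domain_def bounded_iff)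
  show ?thesis
  proof (rule that[of "\<bar>R\<bar> + norm z + 1"])
    fix s assume s: "s \<ge> \<bar>R\<bar> + norm z + 1"
    then have "0 \<le> s" using norm_ge_zero[of z] by linarith
    then have "norm (s *\<^sub>R e) = s" using assms(2) by simp
    then have "norm (z + s *\<^sub>R e) \<ge> s - norm z" using norm_diff_ineq[of "s *\<^sub>R e" z] by (simp add: add.commute)
    then show "z + s *\<^sub>R e \<in> \<Omega>" using R[of "z + s *\<^sub>R e"] s by force
  qed
qed

text \<open>The supremum of the empty set of extended reals is \<open>-\<infinity>\<close>, hence the need for a ray in the domain.\<close>

lemma upper_sup_nonneg:
  fixes \<Omega> :: "'a::euclidean_space set" and u v :: "real \<Rightarrow> 'a \<Rightarrow> real"
  assumes "exterior_domain \<Omega>" "norm e = 1" "A > 0"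
  shows "0 \<le> Sup ((\<lambda>(s, x). ereal (\<bar>u t x\<bar> + \<bar>1 - v t x\<bar>)) `
    {(s, x). s \<ge> c * t \<and> x \<in> cball (z + s *\<^sub>R e) A \<inter> closure \<Omega>})"
proof -
  obtain s\<^sub>0 where s\<^sub>0: "\<And>s. s \<ge> s\<^sub>0 \<Longrightarrow> z + s *\<^sub>R e \<in> \<Omega>"
    using exterior_domain_contains_ray[OF assms(1,2)] by blast
  define s where "s = max s\<^sub>0 (c * t)"
  have "(s, z + s *\<^sub>R e) \<in> {(s, x). s \<ge> c * t \<and> x \<in> cball (z + s *\<^sub>R e) A \<inter> closure \<Omega>}"
    using s\<^sub>0[of s] closure_subset assms(3) by (auto simp: s_def)
  then show ?thesis by (rule Sup_upper2[OF imageI]) (simp add: zero_ereal_def)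
qed

lemma eventually_lower_filter:
  fixes c :: real
  shows "eventually P (inf (at_top \<times>\<^sub>F at_top) (principal {(\<tau>, t). \<tau> \<le> c * t})) \<longleftrightarrow>
    (\<exists>\<tau>\<^sub>0 t\<^sub>0. \<forall>\<tau>\<ge>\<tau>\<^sub>0. \<forall>t\<ge>t\<^sub>0. \<tau> \<le> c * t \<longrightarrow> P (\<tau>, t))" (is "?L \<longleftrightarrow> ?R")
proof
  assume ?L
  then obtain Pf Pg where "eventually Pf at_top" "eventually Pg at_top"
    "\<And>\<tau> t. Pf \<tau> \<Longrightarrow> Pg t \<Longrightarrow> \<tau> \<le> c * t \<longrightarrow> P (\<tau>, t)"
    unfolding eventually_inf_principal eventually_prod_filter by auto
  then show ?R unfolding eventually_at_top_linorder by meson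
next
  assume ?R
  then obtain \<tau>\<^sub>0 t\<^sub>0 where "\<forall>\<tau>\<ge>\<tau>\<^sub>0. \<forall>t\<ge>t\<^sub>0. \<tau> \<le> c * t \<longrightarrow> P (\<tau>, t)" by blast
  then show ?L
    unfolding eventually_inf_principal eventually_prod_filter
    by (intro exI[of _ "\<lambda>\<tau>. \<tau> \<ge> \<tau>\<^sub>0"] exI[of _ "\<lambda>t. t \<ge> t\<^sub>0"]) (auto simp: eventually_ge_at_top)
qed

lemma lower_filter_nontrivial:
  assumes "c > (0::real)"
  shows "inf (at_top \<times>\<^sub>F at_top) (principal {(\<tau>, t). \<tau> \<le> c * t}) \<noteq> bot"
proof
  assume "inf (at_top \<times>\<^sub>F at_top) (principal {(\<tau>, t). \<tau> \<le> c * t}) = bot"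
  then have "eventually (\<lambda>_. False) (inf (at_top \<times>\<^sub>F at_top) (principal {(\<tau>, t). \<tau> \<le> c * t}))"
    by simp
  then obtain \<tau>\<^sub>0 t\<^sub>0 where *: "\<forall>\<tau>\<ge>\<tau>\<^sub>0. \<forall>t\<ge>t\<^sub>0. \<not> \<tau> \<le> c * t"
    unfolding eventually_lower_filter by blast
  have "\<tau>\<^sub>0 \<le> c * max t\<^sub>0 (\<tau>\<^sub>0 / c)"
    using assms mult_left_mono[of "\<tau>\<^sub>0 / c" "max t\<^sub>0 (\<tau>\<^sub>0 / c)" c] by simp
  with * show False by auto
qed

lemma upper_ok_translate:
  assumes \<Omega>: "exterior_domain \<Omega>" and e: "norm e = 1" and A: "A > 0"
    and ok: "upper_ok \<Omega> u v e 0 (A + norm z) c"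
  shows "upper_ok \<Omega> u v e z A c"
  unfolding upper_ok_def
proof (rule tendsto_sandwich[OF _ _ tendsto_const ok[unfolded upper_ok_def]])
  show "\<forall>\<^sub>F t in at_top. 0 \<le> Sup ((\<lambda>(s, x). ereal (\<bar>u t x\<bar> + \<bar>1 - v t x\<bar>)) `
      {(s, x). c * t \<le> s \<and> x \<in> cball (z + s *\<^sub>R e) A \<inter> closure \<Omega>})"
    by (intro always_eventually allI upper_sup_nonneg assms)
  have "dist (0 + s *\<^sub>R e) x \<le> A + norm z" if "dist (z + s *\<^sub>R e) x \<le> A" for s x
    using that dist_triangle[of "s *\<^sub>R e" x "z + s *\<^sub>R e"] by (simp add: dist_norm)
  then show "\<forall>\<^sub>F t in at_top. Sup ((\<lambda>(s, x). ereal (\<bar>u t x\<bar> + \<bar>1 - v t x\<bar>)) `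
      {(s, x). c * t \<le> s \<and> x \<in> cball (z + s *\<^sub>R e) A \<inter> closure \<Omega>})
    \<le> Sup ((\<lambda>(s, x). ereal (\<bar>u t x\<bar> + \<bar>1 - v t x\<bar>)) `
      {(s, x). c * t \<le> s \<and> x \<in> cball (0 + s *\<^sub>R e) (A + norm z) \<inter> closure \<Omega>})"
    by (intro always_eventually allI Sup_subset_mono image_mono) auto
qed

lemma lower_ok_translate:
  assumes \<Omega>: "exterior_domain \<Omega>" and e: "norm e = 1" and A: "A > 0" and c: "c > 0"
    and ok: "lower_ok \<Omega> u v e 0 (A + norm z) c"
  shows "lower_ok \<Omega> u v e z A c"
proof -
  define S where "S z A = (\<lambda>(\<tau>, t). Sup ((\<lambda>(s, x). ereal (\<bar>1 - u t x\<bar> + \<bar>v t x\<bar>)) `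
    {(s, x). \<tau> \<le> s \<and> s \<le> c * t \<and> x \<in> cball (z + s *\<^sub>R e) A \<inter> closure \<Omega>}))" for z A
  define F where "F = inf (at_top \<times>\<^sub>F at_top) (principal {(\<tau>, t). \<tau> \<le> c * t})"
  have "dist (0 + s *\<^sub>R e) x \<le> A + norm z" if "dist (z + s *\<^sub>R e) x \<le> A" for s x
    using that dist_triangle[of "s *\<^sub>R e" x "z + s *\<^sub>R e"] by (simp add: dist_norm)
  then have "S z A y \<le> S 0 (A + norm z) y" for y
    unfolding S_def by (cases y) (auto intro!: Sup_subset_mono image_mono)
  then have "Limsup F (S z A) \<le> Limsup F (S 0 (A + norm z))"
    by (intro Limsup_mono always_eventually allI)
  also have "\<dots> = 0" using ok by (simp add: lower_ok_def S_def F_def)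
  finally have "Limsup F (S z A) \<le> 0" .
  moreover have "0 \<le> Limsup F (S z A)"
  proof (rule le_Limsup)
    show "F \<noteq> bot" unfolding F_def by (rule lower_filter_nontrivial[OF c])
    obtain s\<^sub>0 where s\<^sub>0: "\<And>s. s \<ge> s\<^sub>0 \<Longrightarrow> z + s *\<^sub>R e \<in> \<Omega>"
      using exterior_domain_contains_ray[OF \<Omega> e] by blast
    have "0 \<le> S z A (\<tau>, t)" if "\<tau> \<ge> s\<^sub>0" "\<tau> \<le> c * t" for \<tau> t
    proof -
      have "(\<tau>, z + \<tau> *\<^sub>R e) \<in> {(s, x). \<tau> \<le> s \<and> s \<le> c * t \<and> x \<in> cball (z + s *\<^sub>R e) A \<inter> closure \<Omega>}"
        using s\<^sub>0[of \<tau>] closure_subset A that by auto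
      then show ?thesis unfolding S_def prod.case by (rule Sup_upper2[OF imageI]) (simp add: zero_ereal_def)
    qed
    then show "\<forall>\<^sub>F y in F. 0 \<le> S z A y"
      unfolding F_def eventually_lower_filter by blast
  qed
  ultimately show ?thesis by (simp add: lower_ok_def S_def F_def)
qed

lemma lower_ok_le_upper_ok:
  assumes \<Omega>: "exterior_domain \<Omega>" and e: "norm e = 1" and "A > 0" "A' > 0" "c > 0"
    and low: "lower_ok \<Omega> u v e z A c" and up: "upper_ok \<Omega> u v e z A' c'"
  shows "c \<le> c'"
proof (rule ccontr)
  assume "\<not> c \<le> c'"
  then have cc: "c' < c" by simp
  obtain s\<^sub>0 where s\<^sub>0: "\<And>s. s \<ge> s\<^sub>0 \<Longrightarrow> z + s *\<^sub>R e \<in> \<Omega>"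
    using exterior_domain_contains_ray[OF \<Omega> e] by blast
  have "\<forall>\<^sub>F t in at_top. Sup ((\<lambda>(s, x). ereal (\<bar>u t x\<bar> + \<bar>1 - v t x\<bar>)) `
        {(s, x). s \<ge> c' * t \<and> x \<in> cball (z + s *\<^sub>R e) A' \<inter> closure \<Omega>}) < ereal (1 / 2)"
    by (rule order_tendstoD(2)[OF up[unfolded upper_ok_def]]) (simp add: zero_ereal_def)
  then obtain t1 where t1: "\<And>t. t \<ge> t1 \<Longrightarrow> Sup ((\<lambda>(s, x). ereal (\<bar>u t x\<bar> + \<bar>1 - v t x\<bar>)) `
        {(s, x). s \<ge> c' * t \<and> x \<in> cball (z + s *\<^sub>R e) A' \<inter> closure \<Omega>}) < ereal (1 / 2)"
    by (auto simp: eventually_at_top_linorder)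
  have "\<forall>\<^sub>F y in inf (at_top \<times>\<^sub>F at_top) (principal {(\<tau>, t). \<tau> \<le> c * t}).
      (\<lambda>(\<tau>, t). Sup ((\<lambda>(s,x). ereal (\<bar>1 - u t x\<bar> + \<bar>v t x\<bar>)) `
        {(s,x). \<tau> \<le> s \<and> s \<le> c * t \<and> x \<in> cball (z + s *\<^sub>R e) A \<inter> closure \<Omega>})) y < ereal (1 / 2)"
    by (rule Limsup_lessD) (use low in \<open>simp add: lower_ok_def zero_ereal_def\<close>)
  then obtain \<tau>0 t0 where t0: "\<forall>\<tau>\<ge>\<tau>0. \<forall>t\<ge>t0. \<tau> \<le> c * t \<longrightarrow> Sup ((\<lambda>(s,x). ereal (\<bar>1 - u t x\<bar> + \<bar>v t x\<bar>)) `
        {(s,x). \<tau> \<le> s \<and> s \<le> c * t \<and> x \<in> cball (z + s *\<^sub>R e) A \<inter> closure \<Omega>}) < ereal (1 / 2)"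
    unfolding eventually_lower_filter prod.case by blast
  define t where "t = max (max 0 (max t0 t1)) (max (s\<^sub>0 / c) (\<tau>0 / c))"
  have t: "t \<ge> 0" "t \<ge> t0" "t \<ge> t1" "s\<^sub>0 / c \<le> t" "\<tau>0 / c \<le> t" by (auto simp: t_def)
  then have ct: "s\<^sub>0 \<le> c * t" "\<tau>0 \<le> c * t" "c' * t \<le> c * t"
    using \<open>c > 0\<close> cc by (auto simp: pos_divide_le_eq mult.commute intro: mult_right_mono)
  define x where "x = z + (c * t) *\<^sub>R e"
  have x: "x \<in> closure \<Omega>" using s\<^sub>0[OF ct(1)] closure_subset by (auto simp: x_def)
  have "(c * t, x) \<in> {(s, x). s \<ge> c' * t \<and> x \<in> cball (z + s *\<^sub>R e) A' \<inter> closure \<Omega>}"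
    using x ct \<open>A' > 0\<close> by (auto simp: x_def)
  from le_less_trans[OF Sup_upper[OF imageI[OF this]] t1[OF t(3)]]
  have "\<bar>u t x\<bar> + \<bar>1 - v t x\<bar> < 1 / 2" by simp
  moreover have "(c * t, x) \<in> {(s,x). c * t \<le> s \<and> s \<le> c * t \<and> x \<in> cball (z + s *\<^sub>R e) A \<inter> closure \<Omega>}"
    using x \<open>A > 0\<close> by (auto simp: x_def)
  from le_less_trans[OF Sup_upper[OF imageI[OF this]] t0[rule_format, OF ct(2) t(2) order_refl]]
  have "\<bar>1 - u t x\<bar> + \<bar>v t x\<bar> < 1 / 2" by simp
  ultimately show False by linarith
qed

lemma Rdir_exterior:
  assumes "exterior_domain \<Omega>" "norm e = 1"
  shows "Rdir \<Omega> e = 0"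
proof (rule antisym)
  obtain s\<^sub>0 where s\<^sub>0: "\<And>s. s \<ge> s\<^sub>0 \<Longrightarrow> 0 + s *\<^sub>R e \<in> \<Omega>"
    using exterior_domain_contains_ray[OF assms] by blast
  have "cball (s *\<^sub>R e) 0 \<inter> closure \<Omega> \<noteq> {}" if "s \<ge> s\<^sub>0" for s
    using s\<^sub>0[OF that] closure_subset by auto
  then show "Rdir \<Omega> e \<le> 0"
    unfolding Rdir_def zero_ereal_def by (intro Inf_lower imageI) auto
  show "0 \<le> Rdir \<Omega> e"
    unfolding Rdir_def by (intro Inf_greatest) auto
qed

subsection \<open>Bounds for the competition system\<close>

locale competition =
  fixes \<Omega> :: "'a::euclidean_space set" and d1 d2 r1 r2 a1 a2 :: real
    and u0 v0 :: "'a \<Rightarrow> real" and u v :: "real \<Rightarrow> 'a \<Rightarrow> real"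
  assumes domain: "exterior_domain \<Omega>" "C2_domain \<Omega>"
    and pos: "d1 > 0" "d2 > 0" "r1 > 0" "r2 > 0" "0 < a1" "0 < a2"
    and Theta: "Theta \<Omega> u0 v0"
    and sol: "competition_solution \<Omega> d1 d2 r1 r2 a1 a2 u0 v0 u v"
begin

lemma open_domain: "open \<Omega>" and compact_complement: "compact (- \<Omega>)"
  using domain by (auto simp: exterior_domain_def)

lemma frontier_subset_complement: "frontier \<Omega> \<subseteq> - \<Omega>"
  using open_domain by (auto simp: frontier_def interior_open)

lemma compact_frontier: "compact (frontier \<Omega>)"
  using compact_complement frontier_subset_complement frontier_closed
  by (metis compact_Int_closed inf.absorb_iff2)

lemma initial: "x \<in> closure \<Omega> \<Longrightarrow> u 0 x = u0 x" "x \<in> closure \<Omega> \<Longrightarrow> v 0 x = v0 x"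
  and initial_range: "x \<in> closure \<Omega> \<Longrightarrow> 0 \<le> u0 x" "x \<in> closure \<Omega> \<Longrightarrow> u0 x \<le> 1"
    "x \<in> closure \<Omega> \<Longrightarrow> 0 \<le> v0 x" "x \<in> closure \<Omega> \<Longrightarrow> v0 x \<le> 1"
  using sol Theta by (auto simp: competition_solution_def Theta_def)

lemma regularity:
  shows cont_u: "continuous_on ({0..} \<times> closure \<Omega>) (\<lambda>(t, x). u t x)"
    and cont_v: "continuous_on ({0..} \<times> closure \<Omega>) (\<lambda>(t, x). v t x)"
    and bdd_u: "bounded ((\<lambda>(t, x). u t x) ` ({0..} \<times> closure \<Omega>))"
    and bdd_v: "bounded ((\<lambda>(t, x). v t x) ` ({0..} \<times> closure \<Omega>))"
    and sol_u: "reaction_diffusion_sol \<Omega> d1 (\<lambda>t x. r1 * u t x * (1 - u t x - a1 * v t x)) u"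
    and sol_v: "reaction_diffusion_sol \<Omega> d2 (\<lambda>t x. r2 * v t x * (1 - v t x - a2 * u t x)) v"
  using sol by (auto simp: competition_solution_def)

lemmas comparison_u = exponential_comparison[OF domain(2) compact_frontier less_imp_le[OF pos(1)] cont_u bdd_u sol_u]
lemmas comparison_v = exponential_comparison[OF domain(2) compact_frontier less_imp_le[OF pos(2)] cont_v bdd_v sol_v]

lemma unit_vector: "norm (SOME b. b \<in> (Basis :: 'a set)) = 1"
  by (simp add: SOME_Basis)

lemma reaction_coefficient_bounded:
  "\<exists>B. \<forall>t\<ge>0. \<forall>x\<in>closure \<Omega>. \<bar>r1 * (1 - u t x - a1 * v t x)\<bar> \<le> B \<and> \<bar>r2 * (1 - v t x - a2 * u t x)\<bar> \<le> B"
proof -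
  obtain M N where M: "\<And>t x. t \<ge> 0 \<Longrightarrow> x \<in> closure \<Omega> \<Longrightarrow> \<bar>u t x\<bar> \<le> M"
    and N: "\<And>t x. t \<ge> 0 \<Longrightarrow> x \<in> closure \<Omega> \<Longrightarrow> \<bar>v t x\<bar> \<le> N"
    using bdd_u bdd_v unfolding bounded_iff by force
  have "\<bar>r * (1 - p - a * q)\<bar> \<le> r * (1 + P + a * Q)" if "r > 0" "a > 0" "\<bar>p\<bar> \<le> P" "\<bar>q\<bar> \<le> Q" for r a p q P Q :: real
  proof -
    have "\<bar>a * q\<bar> \<le> a * Q" using that by (simp add: abs_mult)
    then have "\<bar>1 - p - a * q\<bar> \<le> 1 + P + a * Q" using that by linarith
    then show ?thesis using that by (simp add: abs_mult)
  qed
  note * = this[OF pos(3,5) M N] this[OF pos(4,6) N M]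
  show ?thesis
    by (rule exI[of _ "max (r1 * (1 + M + a1 * N)) (r2 * (1 + N + a2 * M))"])
      (use * in \<open>auto simp: le_max_iff_disj\<close>)
qed

lemma nonneg:
  assumes t: "t \<ge> 0" "x \<in> closure \<Omega>"
  shows u_nonneg: "0 \<le> u t x" and v_nonneg: "0 \<le> v t x"
proof -
  obtain B where B: "\<And>t x. t \<ge> 0 \<Longrightarrow> x \<in> closure \<Omega> \<Longrightarrow> r1 * (1 - u t x - a1 * v t x) \<le> B"
    "\<And>t x. t \<ge> 0 \<Longrightarrow> x \<in> closure \<Omega> \<Longrightarrow> r2 * (1 - v t x - a2 * u t x) \<le> B"
    using reaction_coefficient_bounded by (meson abs_le_D1)
  have "- u t x \<le> 0"
  proof (rule comparison_u[OF unit_vector, where W = "\<lambda>t x. - u t x" and \<sigma> = "-1" and \<alpha> = 0 and \<beta> = 0 and B = B])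
    fix t x assume *: "(t::real) > 0" "x \<in> \<Omega>" "- u t x > 0"
    then have "x \<in> closure \<Omega>" using closure_subset by blast
    then have "r1 * (1 - u t x - a1 * v t x) * (- u t x) \<le> B * (- u t x)"
      using * B(1)[of t x] by (intro mult_right_mono) auto
    then show "- 1 * (r1 * u t x * (1 - u t x - a1 * v t x)) \<le> 0 * (0 * (0 - d1 * 0)) *
       exp (- 0 * (x \<bullet> (SOME b. b \<in> Basis) - 0 - 0 * t)) + B * - u t x" by (simp add: algebra_simps)
  qed (use t initial initial_range in auto)
  then show "0 \<le> u t x" by simp
  have "- v t x \<le> 0"
  proof (rule comparison_v[OF unit_vector, where W = "\<lambda>t x. - v t x" and \<sigma> = "-1" and \<alpha> = 0 and \<beta> = 0 and B = B])
    fix t x assume *: "(t::real) > 0" "x \<in> \<Omega>" "- v t x > 0"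
    then have "x \<in> closure \<Omega>" using closure_subset by blast
    then have "r2 * (1 - v t x - a2 * u t x) * (- v t x) \<le> B * (- v t x)"
      using * B(2)[of t x] by (intro mult_right_mono) auto
    then show "- 1 * (r2 * v t x * (1 - v t x - a2 * u t x)) \<le> 0 * (0 * (0 - d2 * 0)) *
       exp (- 0 * (x \<bullet> (SOME b. b \<in> Basis) - 0 - 0 * t)) + B * - v t x" by (simp add: algebra_simps)
  qed (use t initial initial_range in auto)
  then show "0 \<le> v t x" by simp
qed

lemma le_one:
  assumes t: "t \<ge> 0" "x \<in> closure \<Omega>"
  shows u_le_one: "u t x \<le> 1" and v_le_one: "v t x \<le> 1"
proof -
  have "u t x - 1 \<le> 0"
  proof (rule comparison_u[OF unit_vector, where W = "\<lambda>t x. u t x - 1" and \<sigma> = 1 and \<alpha> = "-1" and \<beta> = 0 and B = 0])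
    fix t x assume *: "(t::real) > 0" "x \<in> \<Omega>" "u t x - 1 > 0"
    then have "x \<in> closure \<Omega>" using closure_subset by blast
    then have "0 \<le> a1 * v t x" "0 \<le> r1 * u t x" using * nonneg[of t x] pos by auto
    then have "r1 * u t x * (1 - u t x - a1 * v t x) \<le> 0" using * by (intro mult_nonneg_nonpos) auto
    then show "1 * (r1 * u t x * (1 - u t x - a1 * v t x)) \<le> 0 * (0 * (0 - d1 * 0)) *
       exp (- 0 * (x \<bullet> (SOME b. b \<in> Basis) - 0 - 0 * t)) + 0 * (u t x - 1)" by simp
  qed (use t initial initial_range in auto)
  then show "u t x \<le> 1" by simp
  have "v t x - 1 \<le> 0"
  proof (rule comparison_v[OF unit_vector, where W = "\<lambda>t x. v t x - 1" and \<sigma> = 1 and \<alpha> = "-1" and \<beta> = 0 and B = 0])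
    fix t x assume *: "(t::real) > 0" "x \<in> \<Omega>" "v t x - 1 > 0"
    then have "x \<in> closure \<Omega>" using closure_subset by blast
    then have "0 \<le> a2 * u t x" "0 \<le> r2 * v t x" using * nonneg[of t x] pos by auto
    then have "r2 * v t x * (1 - v t x - a2 * u t x) \<le> 0" using * by (intro mult_nonneg_nonpos) auto
    then show "1 * (r2 * v t x * (1 - v t x - a2 * u t x)) \<le> 0 * (0 * (0 - d2 * 0)) *
       exp (- 0 * (x \<bullet> (SOME b. b \<in> Basis) - 0 - 0 * t)) + 0 * (v t x - 1)" by simp
  qed (use t initial initial_range in auto)
  then show "v t x \<le> 1" by simp
qed

lemma exponential_bounds:
  assumes e: "norm e = 1"
  shows "\<exists>\<mu> K R. \<mu> > 0 \<and> K \<ge> 1 \<and> (\<forall>t\<ge>0. \<forall>x\<in>closure \<Omega>.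
    u t x + (1 - v t x) \<le> K * exp (- \<mu> * (x \<bullet> e - R - 2 * sqrt (d1 * r1) * t)))"
proof -
  obtain K0 where K0: "compact K0" "\<And>x. x \<in> closure \<Omega> - K0 \<Longrightarrow> u0 x = 0 \<and> v0 x = 1"
    using Theta by (auto simp: Theta_def)
  obtain R where R: "\<And>x. x \<in> K0 \<union> - \<Omega> \<Longrightarrow> norm x \<le> R"
    using bounded_Un[THEN iffD2, OF conjI[OF compact_imp_bounded[OF K0(1)] compact_imp_bounded[OF compact_complement]]]
    unfolding bounded_iff by blast
  have xe: "x \<bullet> e \<le> norm x" for x using norm_cauchy_schwarz[of x e] e by simp
  have outside: "u0 x = 0 \<and> v0 x = 1" if "x \<in> closure \<Omega>" "x \<bullet> e > R" for x
    using K0(2)[of x] R[of x] xe[of x] that by force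
  have obstacle: "x \<bullet> e \<le> R" if "x \<in> frontier \<Omega>" for x
    using R[of x] xe[of x] frontier_subset_complement that by force
  define c where "c = 2 * sqrt (d1 * r1)"
  define \<kappa> where "\<kappa> = sqrt (r1 / d1)"
  have c: "c > 0" and \<kappa>: "\<kappa> > 0" using pos by (auto simp: c_def \<kappa>_def)
  have \<kappa>c: "\<kappa> * (c - d1 * \<kappa>) = r1"
  proof -
    have "\<kappa> * c = 2 * r1"
      using pos by (simp add: c_def \<kappa>_def real_sqrt_mult[symmetric] power2_eq_square[symmetric])
    moreover have "\<kappa> * \<kappa> = r1 / d1" using pos by (simp add: \<kappa>_def)
    then have "d1 * (\<kappa> * \<kappa>) = r1" using pos by simp
    ultimately show ?thesis by (simp add: algebra_simps)
  qed
  define E where "E m t x = exp (- m * (x \<bullet> e - R - c * t))" for m t and x :: 'a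
  have E_ge: "1 \<le> E m t x" if "x \<bullet> e \<le> R" "t \<ge> 0" "m > 0" for m t x
  proof -
    have "0 \<le> c * t" using c that by simp
    then have "x \<bullet> e - R - c * t \<le> 0" using that by linarith
    then show ?thesis using that by (simp add: E_def mult_nonneg_nonpos)
  qed
  have E_pos: "E m t x > 0" for m t x by (simp add: E_def)
  have u: "u t x \<le> E \<kappa> t x" if tx: "t \<ge> 0" "x \<in> closure \<Omega>" for t x
  proof -
    have "u t x - E \<kappa> t x \<le> 0"
    proof (rule comparison_u[OF e, where W = "\<lambda>t x. u t x - E \<kappa> t x" and \<sigma> = 1 and \<alpha> = 0 and \<beta> = 1 and B = r1
          and \<kappa> = \<kappa> and R = R and c = c])
      show "u 0 x - E \<kappa> 0 x \<le> 0" if "x \<in> closure \<Omega>" for x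
        using outside[OF that] E_ge[of x 0 \<kappa>] \<kappa> E_pos[of \<kappa> 0 x] initial(1)[OF that] initial_range(2)[OF that]
        by (cases "x \<bullet> e \<le> R") auto
      show "u t x - E \<kappa> t x \<le> 0" if "t > 0" "x \<in> frontier \<Omega>" for t x
        using E_ge[of x t \<kappa>] obstacle that \<kappa> u_le_one[of t x] by (auto simp: frontier_def)
      fix t x assume *: "(t::real) > 0" "x \<in> \<Omega>"
      then have xc: "x \<in> closure \<Omega>" using closure_subset by blast
      have "0 \<le> a1 * v t x" using v_nonneg[of t x] * xc pos by simp
      then have "r1 * u t x * (1 - u t x - a1 * v t x) \<le> r1 * u t x * 1"
        using u_nonneg[of t x] * xc pos by (intro mult_left_mono) auto
      then show "1 * (r1 * u t x * (1 - u t x - a1 * v t x)) \<le>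
          1 * (\<kappa> * (c - d1 * \<kappa>)) * exp (- \<kappa> * (x \<bullet> e - R - c * t)) + r1 * (u t x - E \<kappa> t x)"
        unfolding \<kappa>c E_def by (simp add: algebra_simps)
    qed (use tx in \<open>auto simp: E_def\<close>)
    then show ?thesis by simp
  qed
  define \<mu> where "\<mu> = min \<kappa> (c / (2 * d2))"
  have \<mu>: "\<mu> > 0" "\<mu> \<le> \<kappa>" using c \<kappa> pos by (auto simp: \<mu>_def)
  have "d2 * \<mu> \<le> d2 * (c / (2 * d2))" using pos by (intro mult_left_mono) (auto simp: \<mu>_def)
  also have "\<dots> < c" using pos c by simp
  finally have \<mu>c: "\<mu> * (c - d2 * \<mu>) > 0" using \<mu> by simp
  define K where "K = max 1 (r2 * a2 / (\<mu> * (c - d2 * \<mu>)))"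
  have K: "K \<ge> 1" "r2 * a2 \<le> K * (\<mu> * (c - d2 * \<mu>))"
    using \<mu>c by (auto simp: K_def pos_divide_le_eq[symmetric])
  have E_mono: "E \<kappa> t x \<le> E \<mu> t x" if "E \<mu> t x \<le> 1" for t x
  proof -
    have "0 \<le> x \<bullet> e - R - c * t" using that \<mu> by (simp add: E_def zero_le_mult_iff)
    then show ?thesis using \<mu> by (simp add: E_def mult_right_mono)
  qed
  have v: "1 - v t x \<le> K * E \<mu> t x" if tx: "t \<ge> 0" "x \<in> closure \<Omega>" for t x
  proof -
    have KE: "1 \<le> K * E \<mu> t x" if "1 \<le> E \<mu> t x" for t x
      using mult_mono[OF K(1) that] K by simp
    have "(1 - v t x) - K * E \<mu> t x \<le> 0"
    proof (rule comparison_v[OF e, where W = "\<lambda>t x. (1 - v t x) - K * E \<mu> t x" and \<sigma> = "-1" and \<alpha> = 1 and \<beta> = K and B = 0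
          and \<kappa> = \<mu> and R = R and c = c])
      show "(1 - v 0 x) - K * E \<mu> 0 x \<le> 0" if "x \<in> closure \<Omega>" for x
        using outside[OF that] KE[OF E_ge[of x 0 \<mu>]] \<mu> K mult_pos_pos[OF _ E_pos[of \<mu> 0 x], of K]
          initial(2)[OF that] initial_range(3)[OF that]
        by (cases "x \<bullet> e \<le> R") auto
      show "(1 - v t x) - K * E \<mu> t x \<le> 0" if "t > 0" "x \<in> frontier \<Omega>" for t x
        using KE[OF E_ge[of x t \<mu>]] obstacle that \<mu> v_nonneg[of t x] by (auto simp: frontier_def)
      fix t x assume *: "(t::real) > 0" "x \<in> \<Omega>" "(1 - v t x) - K * E \<mu> t x > 0"
      then have xc: "x \<in> closure \<Omega>" using closure_subset by blast
      have v01: "0 \<le> v t x" "v t x \<le> 1" "0 \<le> u t x" using nonneg[of t x] le_one[of t x] * xc by auto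
      have "E \<mu> t x \<le> 1" using KE[of t x] * v01 by force
      then have "u t x \<le> E \<mu> t x" using u[of t x] E_mono[of t x] * xc by auto
      then have "r2 * a2 * u t x \<le> K * (\<mu> * (c - d2 * \<mu>)) * E \<mu> t x"
        by (intro mult_mono K(2)) (use K \<mu>c v01 in auto)
      moreover have "r2 * a2 * u t x * v t x \<le> r2 * a2 * u t x * 1"
        using v01 pos by (intro mult_left_mono) auto
      moreover have "0 \<le> r2 * v t x * (1 - v t x)" using v01 pos by simp
      ultimately show "- 1 * (r2 * v t x * (1 - v t x - a2 * u t x)) \<le>
          K * (\<mu> * (c - d2 * \<mu>)) * exp (- \<mu> * (x \<bullet> e - R - c * t)) + 0 * ((1 - v t x) - K * E \<mu> t x)"
        unfolding E_def by (simp add: algebra_simps)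
    qed (use tx K in \<open>auto simp: E_def\<close>)
    then show ?thesis by simp
  qed
  show ?thesis
  proof (rule exI[of _ \<mu>], rule exI[of _ "1 + K"], rule exI[of _ R], intro conjI allI impI ballI)
    fix t x assume tx: "(t::real) \<ge> 0" "x \<in> closure \<Omega>"
    have "u t x \<le> E \<mu> t x"
      using u[OF tx] E_mono[of t x] u_le_one[OF tx] by linarith
    with v[OF tx] show "u t x + (1 - v t x) \<le> (1 + K) * exp (- \<mu> * (x \<bullet> e - R - 2 * sqrt (d1 * r1) * t))"
      by (simp add: E_def c_def distrib_right)
  qed (use \<mu> K in auto)
qed

lemma upper_ok_above_KPP_speed:
  assumes e: "norm e = 1" and c: "c > 2 * sqrt (d1 * r1)" and A: "A > 0"
  shows "upper_ok \<Omega> u v e 0 A c"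
proof -
  obtain \<mu> K R where \<mu>: "\<mu> > 0" and K: "K \<ge> 1" and
    bound: "\<forall>t\<ge>0. \<forall>x\<in>closure \<Omega>.
      u t x + (1 - v t x) \<le> K * exp (- \<mu> * (x \<bullet> e - R - 2 * sqrt (d1 * r1) * t))"
    using exponential_bounds[OF e] by (elim exE conjE)
  define k where "k = \<mu> * (c - 2 * sqrt (d1 * r1))"
  define C where "C = K * exp (\<mu> * (A + R))"
  have k: "k > 0" using \<mu> c by (simp add: k_def)
  have "filterlim (\<lambda>t. k * t) at_top at_top"
    by (rule filterlim_tendsto_pos_mult_at_top[OF tendsto_const k filterlim_ident])
  then have "((\<lambda>t. exp (- (k * t))) \<longlongrightarrow> 0) at_top"
    by (intro filterlim_compose[OF exp_at_bot]) (simp add: filterlim_uminus_at_bot)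
  from tendsto_mult_right_zero[OF this, of C]
  have lim: "((\<lambda>t. ereal (C * exp (- (k * t)))) \<longlongrightarrow> 0) at_top"
    by (simp add: zero_ereal_def)
  have val: "\<bar>u t x\<bar> + \<bar>1 - v t x\<bar> \<le> C * exp (- (k * t))"
    if "t \<ge> 0" "s \<ge> c * t" "x \<in> cball (0 + s *\<^sub>R e) A \<inter> closure \<Omega>" for t s x
  proof -
    have "s - x \<bullet> e = (s *\<^sub>R e - x) \<bullet> e" using e by (simp add: inner_diff_left dot_square_norm)
    also have "\<dots> \<le> A" using that norm_cauchy_schwarz[of "s *\<^sub>R e - x" e] e by (simp add: dist_norm)
    finally have "\<mu> * (c * t - A - R - 2 * sqrt (d1 * r1) * t) \<le> \<mu> * (x \<bullet> e - R - 2 * sqrt (d1 * r1) * t)"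
      using that \<mu> by (intro mult_left_mono) auto
    then have "- \<mu> * (x \<bullet> e - R - 2 * sqrt (d1 * r1) * t) \<le> \<mu> * (A + R) + - (k * t)"
      by (simp add: k_def algebra_simps)
    then have "K * exp (- \<mu> * (x \<bullet> e - R - 2 * sqrt (d1 * r1) * t)) \<le> K * exp (\<mu> * (A + R) + - (k * t))"
      using K by (intro mult_left_mono) auto
    also have "\<dots> = C * exp (- (k * t))" unfolding C_def exp_add by simp
    finally show ?thesis using bound[rule_format, of t x] u_nonneg[of t x] v_le_one[of t x] that by auto
  qed
  show ?thesis unfolding upper_ok_def
  proof (rule tendsto_sandwich[OF _ _ tendsto_const lim])
    show "\<forall>\<^sub>F t in at_top. 0 \<le> Sup ((\<lambda>(s, x). ereal (\<bar>u t x\<bar> + \<bar>1 - v t x\<bar>)) `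
        {(s, x). c * t \<le> s \<and> x \<in> cball (0 + s *\<^sub>R e) A \<inter> closure \<Omega>})"
      by (intro always_eventually allI upper_sup_nonneg) (use domain e A in auto)
    show "\<forall>\<^sub>F t in at_top. Sup ((\<lambda>(s, x). ereal (\<bar>u t x\<bar> + \<bar>1 - v t x\<bar>)) `
        {(s, x). c * t \<le> s \<and> x \<in> cball (0 + s *\<^sub>R e) A \<inter> closure \<Omega>}) \<le> ereal (C * exp (- (k * t)))"
      using eventually_ge_at_top[of 0] by eventually_elim (use val in \<open>auto intro!: Sup_least\<close>)
  qed
qed

end

theorem mainTheorem8:
  fixes \<Omega> :: "'a::euclidean_space set"
    and d1 d2 r1 r2 a1 a2 :: real
    and u0 v0 :: "'a \<Rightarrow> real"
    and u v :: "real \<Rightarrow> 'a \<Rightarrow> real"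
    and e z :: 'a
  assumes "DIM('a) \<ge> 2"
    and "exterior_domain \<Omega>" and "C2_domain \<Omega>"
    and "d1 > 0" "d2 > 0" "r1 > 0" "r2 > 0" "0 < a1" "a1 < 1" "1 < a2"
    and "Theta \<Omega> u0 v0"
    and "competition_solution \<Omega> d1 d2 r1 r2 a1 a2 u0 v0 u v"
    and "norm e = 1"
  shows "w_low \<Omega> u v e \<le> w_low_z \<Omega> u v e z \<and>
         w_low_z \<Omega> u v e z \<le> w_up_z \<Omega> u v e z \<and>
         w_up_z \<Omega> u v e z \<le> w_up \<Omega> u v e \<and>
         w_up \<Omega> u v e \<le> ereal (2 * sqrt r1 * max (sqrt d1) (sqrt (d2 / 2)))"
proof (intro conjI)
  interpret competition \<Omega> d1 d2 r1 r2 a1 a2 u0 v0 u v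
    using assms by unfold_locales auto
  note dom = \<open>exterior_domain \<Omega>\<close> and e = \<open>norm e = 1\<close>
  have R: "Rdir \<Omega> e = 0" by (rule Rdir_exterior[OF dom e])
  have A: "ereal (1 + norm z) > Rdir \<Omega> e" using norm_ge_zero[of z] by (simp add: R add_pos_nonneg)
  show "w_low \<Omega> u v e \<le> w_low_z \<Omega> u v e z"
  proof -
    define C where "C = {c. c > 0 \<and> (\<forall>A. ereal A > Rdir \<Omega> e \<longrightarrow> lower_ok \<Omega> u v e 0 A c)}"
    define C' where "C' = {c. c > 0 \<and> (\<exists>A>0. lower_ok \<Omega> u v e z A c)}"
    have "C \<subseteq> C'"
    proof
      fix c assume "c \<in> C"
      then have "c > 0" "lower_ok \<Omega> u v e 0 (1 + norm z) c" using A by (auto simp: C_def)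
      then have "lower_ok \<Omega> u v e z 1 c" using lower_ok_translate[OF dom e zero_less_one] by blast
      with \<open>c > 0\<close> show "c \<in> C'" unfolding C'_def by (auto intro!: exI[of _ 1])
    qed
    then have "Sup (ereal ` C) \<le> Sup (ereal ` C')" by (intro Sup_subset_mono image_mono)
    moreover have "0 \<le> Sup (ereal ` C')" if "C' \<noteq> {}"
    proof -
      from that obtain c where "c \<in> C'" by blast
      then show ?thesis by (intro Sup_upper2[of "ereal c"]) (auto simp: C'_def)
    qed
    ultimately show ?thesis
      using \<open>C \<subseteq> C'\<close> unfolding w_low_def w_low_z_def C_def[symmetric] C'_def[symmetric] Let_def by auto
  qed
  show "w_low_z \<Omega> u v e z \<le> w_up_z \<Omega> u v e z"
    unfolding w_up_z_def
  proof (rule Inf_greatest)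
    fix b assume "b \<in> ereal ` {c. c > 0 \<and> (\<exists>A>0. upper_ok \<Omega> u v e z A c)}"
    then obtain c A where c: "b = ereal c" "c > 0" "A > 0" "upper_ok \<Omega> u v e z A c" by auto
    then show "w_low_z \<Omega> u v e z \<le> b"
      unfolding w_low_z_def Let_def
      by (auto intro!: Sup_least intro: lower_ok_le_upper_ok[OF dom e])
  qed
  show "w_up_z \<Omega> u v e z \<le> w_up \<Omega> u v e"
    unfolding w_up_z_def w_up_def
  proof (intro Inf_superset_mono image_mono subsetI)
    fix c assume "c \<in> {c. c > 0 \<and> (\<forall>A. ereal A > Rdir \<Omega> e \<longrightarrow> upper_ok \<Omega> u v e 0 A c)}"
    then have "c > 0" "upper_ok \<Omega> u v e 0 (1 + norm z) c" using A by auto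
    then have "upper_ok \<Omega> u v e z 1 c" using upper_ok_translate[OF dom e zero_less_one] by blast
    with \<open>c > 0\<close> show "c \<in> {c. c > 0 \<and> (\<exists>A>0. upper_ok \<Omega> u v e z A c)}" by (auto intro!: exI[of _ 1])
  qed
  have "w_up \<Omega> u v e \<le> ereal (2 * sqrt (d1 * r1))"
  proof (rule ereal_le_epsilon2)
    fix \<epsilon> :: real assume \<epsilon>: "\<epsilon> > 0"
    have "2 * sqrt (d1 * r1) + \<epsilon> > 0" using \<epsilon> pos by (intro add_nonneg_pos) auto
    moreover have "upper_ok \<Omega> u v e 0 A (2 * sqrt (d1 * r1) + \<epsilon>)" if "ereal A > Rdir \<Omega> e" for A
      by (rule upper_ok_above_KPP_speed[OF e]) (use \<epsilon> that R in auto)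
    ultimately have "w_up \<Omega> u v e \<le> ereal (2 * sqrt (d1 * r1) + \<epsilon>)"
      unfolding w_up_def by (intro Inf_lower imageI) auto
    then show "w_up \<Omega> u v e \<le> ereal (2 * sqrt (d1 * r1)) + ereal \<epsilon>" by simp
  qed
  also have "2 * sqrt (d1 * r1) \<le> 2 * sqrt r1 * max (sqrt d1) (sqrt (d2 / 2))"
    using pos by (simp add: real_sqrt_mult mult.commute mult_left_mono)
  finally show "w_up \<Omega> u v e \<le> ereal (2 * sqrt r1 * max (sqrt d1) (sqrt (d2 / 2)))" by simp
qed

end
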